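(* Let $G\subset\mathbb R^n$ be a bounded domain with $C^\infty$ boundary $\Gamma$, $T>0$, and $a_1,a_2\in L^\infty_{\mathbb F}(0,T;L^\infty(G))$. The controlled stochastic hyperbolic equation $$\begin{cases} dy_t-\Delta y\,dt=(a_1y+g_1)\,dt+(a_2y+g_2)\,dW(t)&\text{in }(0,T)\times G,\\ y=h&\text{on }(0,T)\times\Gamma,\\ y(0)=y_0,\quad y_t(0)=y_1&\text{in }G\end{cases}$$ is not exactly controllable at any time $T>0$. Here exact controllability at time $T$ means: for any $(y_0,y_1)\in L^2(G)\times H^{-1}(G)$ and any $(\tilde y_0,\tilde y_1)\in L^2_{\mathcal F_T}(\Omega;L^2(G))\times L^2_{\mathcal F_T}(\Omega;H^{-1}(G))$ there is a triple of controls $(g_1,g_2,h)\in L^2_{\mathbb F}(0,T;H^{-1}(G))\times L^2_{\mathbb F}(0,T;H^{-1}(G))\times L^2_{\mathbb F}(0,T;L^2(\Gamma))$ such that the corresponding transposition solution satisfies $(y(T),y_t(T))=(\tilde y_0,\tilde y_1)$ a.s.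
   Context: Stochastic setting. $(\Omega,\mathcal F,\mathbf F,\mathbb P)$, $\mathbf F=\{\mathcal F_t\}_{t\in[0,T]}$, is a complete filtered probability space carrying a one-dimensional standard Brownian motion $W$, and $\mathbf F$ is the natural filtration generated by $W$ (augmented by all $\mathbb P$-null sets). "Adapted" means progressively measurable. For a Banach space $X$: $L^2_{\mathcal F_t}(\Omega;X)$ is the space of $\mathcal F_t$-measurable square integrable $X$-valued random variables; $L^2_{\mathbb F}(0,T;X)$ the space of adapted processes square integrable on $(0,T)\times\Omega$; $L^\infty_{\mathbb F}(0,T;X)$ the essentially bounded adapted processes; $L^2_{\mathbb F}(\Omega;C([0,T];X))$ the continuous adapted processes $\varphi$ with $\mathbb E|\varphi|^2_{C([0,T];X)}<\infty$; $C_{\mathbb F}([0,T];L^2(\Omega;X))$ the adapted processes continuous from $[0,T]$ to $L^2_{\mathcal F_T}(\Omega;X)$; $C^1_{\mathbb F}([0,T];L^2(\Omega;X))$ those which are continuously differentiable in $t$ with values in $L^2(\Omega;X)$ and with derivative in $C_{\mathbb F}([0,T];L^2(\Omega;X))$. Backward equation. For $\tau\in(0,T]$ and $(z^\tau,\hat z^\tau)\in L^2_{\mathcal F_\tau}(\Omega;H^1_0(G))\times L^2_{\mathcal F_\tau}(\Omega;L^2(G))$, let $(z,\hat z,Z,\widehat Z)\in L^2_{\mathbb F}(\Omega;C([0,\tau];H^1_0(G)))\times L^2_{\mathbb F}(\Omega;C([0,\tau];L^2(G)))\times L^2_{\mathbb F}(0,\tau;H^1_0(G))\times L^2_{\mathbb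 F}(0,\tau;L^2(G))$ be the unique mild solution of $$\begin{cases}dz=\hat z\,dt+Z\,dW(t)&\text{in }(0,\tau)\times G,\\ d\hat z-\Delta z\,dt=(a_1z+a_2Z)\,dt+\widehat Z\,dW(t)&\text{in }(0,\tau)\times G,\\ z=0&\text{on }(0,\tau)\times\Gamma,\\ z(\tau)=z^\tau,\ \hat z(\tau)=\hat z^\tau&\text{in }G.\end{cases}$$ Its normal derivative $\frac{\partial z}{\partial\nu}\in L^2_{\mathbb F}(0,\tau;L^2(\Gamma))$ ($\nu$ the unit outward normal) is understood as the limit, as $\lambda\to+\infty$, of the normal derivatives $\frac{\partial z_\lambda}{\partial\nu}$ with $(z_\lambda,\hat z_\lambda)=\lambda(\lambda I-\mathcal A)^{-1}(z,\hat z)$, where $\mathcal A(f,g)=(g,\Delta f)$ on $H^1_0(G)\times L^2(G)$ with domain $(H^2(G)\cap H^1_0(G))\times H^1_0(G)$ (this limit exists). Transposition solution. A process $y\in C_{\mathbb F}([0,T];L^2(\Omega;L^2(G)))\cap C^1_{\mathbb F}([0,T];L^2(\Omega;H^{-1}(G)))$ is a transposition solution of the controlled equation if for every $\tau\in(0,T]$ and every $(z^\tau,\hat z^\tau)\in L^2_{\mathcal F_\tau}(\Omega;H^1_0(G))\times L^2_{\mathcal F_\tau}(\Omega;L^2(G))$, with $(z,\hat z,Z,\widehat Z)$ the mild solution of the backward equation with terminal data $z(\tau)=z^\tau$, $\hat z(\tau)=\hat z^\tau$, $$\begin{aligned}&\mathbb E\langle y_t(\tau),z^\tau\rangle_{H^{-1},H^1_0}-\langle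 y_1,z(0)\rangle_{H^{-1},H^1_0}-\mathbb E\langle y(\tau),\hat z^\tau\rangle_{L^2(G)}+\langle y_0,\hat z(0)\rangle_{L^2(G)}\\&=\mathbb E\int_0^\tau\langle g_1,z\rangle_{H^{-1},H^1_0}dt+\mathbb E\int_0^\tau\langle g_2,Z\rangle_{H^{-1},H^1_0}dt-\mathbb E\int_0^\tau\int_\Gamma\frac{\partial z}{\partial\nu}h\,d\Gamma\,dt.\end{aligned}$$ Such a solution exists and is unique for all data $(y_0,y_1)\in L^2(G)\times H^{-1}(G)$ and all controls $(g_1,g_2,h)\in L^2_{\mathbb F}(0,T;H^{-1}(G))\times L^2_{\mathbb F}(0,T;H^{-1}(G))\times L^2_{\mathbb F}(0,T;L^2(\Gamma))$. *)

theory Defs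
  imports "HOL-Probability.Probability" "HOL-Library.Function_Algebras"
begin

section \<open>Function spaces given by representatives\<close>

instantiation "fun" :: (type, real_vector) real_vector
begin

definition scaleR_fun_def: "c *\<^sub>R f = (\<lambda>x. c *\<^sub>R f x)"

instance
  by standard (simp_all add: scaleR_fun_def fun_eq_iff scaleR_add_right scaleR_add_left)

end

text \<open>
  A normed space is given by a carrier of representatives inside a real vector space and a seminorm
  on this carrier; two representatives at seminorm distance 0 are the same element. So equality of
  elements is always expressed by \<open>nrm X (u - v) = 0\<close>.
\<close>

record 'v nspace =
  elts :: "'v set"
  nrm :: "'v \<Rightarrow> real"

definition prod_nspace :: "('u::real_vector) nspace \<Rightarrow> ('v::real_vector) nspace \<Rightarrow> ('u \<times> 'v) nspace"
  where "prod_nspace X Y =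
    \<lparr>elts = elts X \<times> elts Y, nrm = (\<lambda>(u, v). sqrt ((nrm X u)\<^sup>2 + (nrm Y v)\<^sup>2))\<rparr>"

definition dual_nspace :: "('v::real_vector) nspace \<Rightarrow> ('v \<Rightarrow> real) nspace"
  where "dual_nspace X =
    \<lparr>elts = {F. (\<forall>u\<in>elts X. \<forall>v\<in>elts X. \<forall>c. F (c *\<^sub>R u + v) = c * F u + F v) \<and>
               (\<exists>C. \<forall>u\<in>elts X. \<bar>F u\<bar> \<le> C * nrm X u)},
     nrm = (\<lambda>F. SUP u\<in>{u \<in> elts X. nrm X u \<le> 1}. \<bar>F u\<bar>)\<rparr>"

text \<open>Strong (Bochner) measurability: pointwise limits of simple functions. The first argument
  contributes only its sigma-algebra.\<close>

definition strongly_measurable :: "'w measure \<Rightarrow> ('v::real_vector) nspace \<Rightarrow> ('w \<Rightarrow> 'v) \<Rightarrow> bool"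
  where "strongly_measurable M X f \<longleftrightarrow>
    (\<forall>w\<in>space M. f w \<in> elts X) \<and>
    (\<exists>s :: nat \<Rightarrow> 'w \<Rightarrow> 'v.
       (\<forall>k. simple_function M (s k) \<and> (\<forall>w\<in>space M. s k w \<in> elts X)) \<and>
       (\<forall>w\<in>space M. (\<lambda>k. nrm X (s k w - f w)) \<longlonglongrightarrow> 0))"

text \<open>The counterpart of \<^const>\<open>has_bochner_integral\<close>. The integrand may leave the space on a
  null set.\<close>

definition bochner_integral_in ::
    "'w measure \<Rightarrow> ('v::real_vector) nspace \<Rightarrow> ('w \<Rightarrow> 'v) \<Rightarrow> 'v \<Rightarrow> bool"
  where "bochner_integral_in M X f I \<longleftrightarrow> I \<in> elts X \<and>
    (\<exists>g. strongly_measurable M X g \<and> (AE w in M. f w \<in> elts X \<and> nrm X (f w - g w) = 0) \<and>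
      (\<exists>s :: nat \<Rightarrow> 'w \<Rightarrow> 'v.
         (\<forall>k. Bochner_Integration.simple_bochner_integrable M (s k) \<and> (\<forall>w\<in>space M. s k w \<in> elts X)) \<and>
         (\<lambda>k. \<integral>\<^sup>+w. ennreal (nrm X (g w - s k w)) \<partial>M) \<longlonglongrightarrow> 0 \<and>
         (\<lambda>k. nrm X (Bochner_Integration.simple_bochner_integral M (s k) - I)) \<longlonglongrightarrow> 0))"

definition L2 :: "'a measure \<Rightarrow> ('a \<Rightarrow> real) nspace"
  where "L2 M =
    \<lparr>elts = {u \<in> borel_measurable M. integrable M (\<lambda>x. (u x)\<^sup>2)},
     nrm = (\<lambda>u. sqrt (\<integral>x. (u x)\<^sup>2 \<partial>M))\<rparr>"

section \<open>Smooth functions and smooth domains\<close>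

fun iter_partial :: "('a::euclidean_space) list \<Rightarrow> ('a \<Rightarrow> real) \<Rightarrow> 'a \<Rightarrow> real" where
  "iter_partial [] f = f"
| "iter_partial (b # bs) f = (\<lambda>x. frechet_derivative (iter_partial bs f) (at x) b)"

definition smooth_on :: "('a::euclidean_space) set \<Rightarrow> ('a \<Rightarrow> real) \<Rightarrow> bool"
  where "smooth_on U f \<longleftrightarrow> open U \<and> (\<forall>bs\<in>lists Basis. iter_partial bs f differentiable_on U)"

definition test_functions :: "('a::euclidean_space) set \<Rightarrow> ('a \<Rightarrow> real) set"
  where "test_functions G = {\<phi>. smooth_on UNIV \<phi> \<and>
    compact (closure {x. \<phi> x \<noteq> 0}) \<and> closure {x. \<phi> x \<noteq> 0} \<subseteq> G}"

definition local_defining_function ::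
    "('a::euclidean_space) set \<Rightarrow> 'a set \<Rightarrow> ('a \<Rightarrow> real) \<Rightarrow> bool"
  where "local_defining_function G U \<rho> \<longleftrightarrow> smooth_on U \<rho> \<and>
    (\<forall>y\<in>U. \<exists>D. D \<noteq> 0 \<and> GDERIV \<rho> y :> D) \<and> G \<inter> U = {y \<in> U. \<rho> y < 0}"

definition bounded_smooth_domain :: "('a::euclidean_space) set \<Rightarrow> bool"
  where "bounded_smooth_domain G \<longleftrightarrow> open G \<and> connected G \<and> G \<noteq> {} \<and> bounded G \<and>
    (\<forall>x\<in>frontier G. \<exists>U \<rho>. x \<in> U \<and> local_defining_function G U \<rho>)"

definition outward_normal :: "('a::euclidean_space) set \<Rightarrow> 'a \<Rightarrow> 'a"
  where "outward_normal G x = (THE \<nu>. \<exists>U \<rho> D. x \<in> U \<and> local_defining_function G U \<rho> \<and>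
    GDERIV \<rho> x :> D \<and> \<nu> = D /\<^sub>R norm D)"

text \<open>The surface measure on the boundary is the Hausdorff measure of dimension \<open>n - 1\<close>, normalised so
  that it is the Euclidean surface area. The natural-number power \<open>0 ^ 0 = 1\<close> makes it the counting
  measure for \<open>n = 1\<close>.\<close>

definition hausdorff_cost :: "nat \<Rightarrow> ('a::euclidean_space) set \<Rightarrow> ennreal"
  where "hausdorff_cost d U =
    (if U = {} then 0 else ennreal (unit_ball_vol (real d) * (diameter U / 2) ^ d))"

definition hausdorff_outer :: "nat \<Rightarrow> ('a::euclidean_space) set \<Rightarrow> ennreal"
  where "hausdorff_outer d A = (SUP \<delta>\<in>{0::real<..}.
    INF U\<in>{U :: nat \<Rightarrow> 'a set. A \<subseteq> (\<Union>i. U i) \<and> (\<forall>i. bounded (U i) \<and> diameter (U i) \<le> \<delta>)}.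
      (\<Sum>i. hausdorff_cost d (U i)))"

definition surface_measure :: "('a::euclidean_space) set \<Rightarrow> 'a measure"
  where "surface_measure G = restrict_space
    (measure_of UNIV (sets borel) (hausdorff_outer (DIM('a) - 1))) (frontier G)"

section \<open>Sobolev spaces, traces and normal derivatives\<close>

abbreviation L2_dom :: "('a::euclidean_space) set \<Rightarrow> ('a \<Rightarrow> real) nspace"
  where "L2_dom G \<equiv> L2 (lebesgue_on G)"

abbreviation L2_bdry :: "('a::euclidean_space) set \<Rightarrow> ('a \<Rightarrow> real) nspace"
  where "L2_bdry G \<equiv> L2 (surface_measure G)"

definition is_weak_deriv ::
    "('a::euclidean_space) set \<Rightarrow> 'a \<Rightarrow> ('a \<Rightarrow> real) \<Rightarrow> ('a \<Rightarrow> real) \<Rightarrow> bool"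
  where "is_weak_deriv G b u v \<longleftrightarrow> v \<in> elts (L2_dom G) \<and>
    (\<forall>\<phi>\<in>test_functions G.
       (\<integral>x. u x * frechet_derivative \<phi> (at x) b \<partial>lebesgue_on G)
         = - (\<integral>x. v x * \<phi> x \<partial>lebesgue_on G))"

definition weak_deriv :: "('a::euclidean_space) set \<Rightarrow> 'a \<Rightarrow> ('a \<Rightarrow> real) \<Rightarrow> 'a \<Rightarrow> real"
  where "weak_deriv G b u = (SOME v. is_weak_deriv G b u v)"

definition H1 :: "('a::euclidean_space) set \<Rightarrow> ('a \<Rightarrow> real) nspace"
  where "H1 G =
    \<lparr>elts = {u \<in> elts (L2_dom G). \<forall>b\<in>Basis. \<exists>v. is_weak_deriv G b u v},
     nrm = (\<lambda>u. sqrt ((nrm (L2_dom G) u)\<^sup>2 + (\<Sum>b\<in>Basis. (nrm (L2_dom G) (weak_deriv G b u))\<^sup>2)))\<rparr>"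

definition H10 :: "('a::euclidean_space) set \<Rightarrow> ('a \<Rightarrow> real) nspace"
  where "H10 G =
    \<lparr>elts = {u \<in> elts (H1 G). \<exists>\<phi> :: nat \<Rightarrow> 'a \<Rightarrow> real.
        (\<forall>k. \<phi> k \<in> test_functions G) \<and> (\<lambda>k. nrm (H1 G) (\<phi> k - u)) \<longlonglongrightarrow> 0},
     nrm = nrm (H1 G)\<rparr>"

definition Hm1 :: "('a::euclidean_space) set \<Rightarrow> (('a \<Rightarrow> real) \<Rightarrow> real) nspace"
  where "Hm1 G = dual_nspace (H10 G)"

definition L2_to_Hm1 :: "('a::euclidean_space) set \<Rightarrow> ('a \<Rightarrow> real) \<Rightarrow> ('a \<Rightarrow> real) \<Rightarrow> real"
  where "L2_to_Hm1 G u = (\<lambda>v. \<integral>x. u x * v x \<partial>lebesgue_on G)"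

definition H2 :: "('a::euclidean_space) set \<Rightarrow> ('a \<Rightarrow> real) set"
  where "H2 G = {u \<in> elts (H1 G). \<forall>b\<in>Basis. weak_deriv G b u \<in> elts (H1 G)}"

definition laplacian :: "('a::euclidean_space) set \<Rightarrow> ('a \<Rightarrow> real) \<Rightarrow> 'a \<Rightarrow> real"
  where "laplacian G u = (\<Sum>b\<in>Basis. weak_deriv G b (weak_deriv G b u))"

definition is_trace :: "('a::euclidean_space) set \<Rightarrow> ('a \<Rightarrow> real) \<Rightarrow> ('a \<Rightarrow> real) \<Rightarrow> bool"
  where "is_trace G u t \<longleftrightarrow> u \<in> elts (H1 G) \<and> t \<in> elts (L2_bdry G) \<and>
    (\<exists>\<phi> :: nat \<Rightarrow> 'a \<Rightarrow> real. (\<forall>k. smooth_on UNIV (\<phi> k)) \<and>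
       (\<lambda>k. nrm (H1 G) (\<phi> k - u)) \<longlonglongrightarrow> 0 \<and> (\<lambda>k. nrm (L2_bdry G) (\<phi> k - t)) \<longlonglongrightarrow> 0)"

definition is_normal_deriv :: "('a::euclidean_space) set \<Rightarrow> ('a \<Rightarrow> real) \<Rightarrow> ('a \<Rightarrow> real) \<Rightarrow> bool"
  where "is_normal_deriv G u p \<longleftrightarrow> u \<in> H2 G \<and> p \<in> elts (L2_bdry G) \<and>
    (\<exists>t. (\<forall>b\<in>Basis. is_trace G (weak_deriv G b u) (t b)) \<and>
       nrm (L2_bdry G) (p - (\<lambda>x. \<Sum>b\<in>Basis. (outward_normal G x \<bullet> b) * t b x)) = 0)"

section \<open>The wave group\<close>

definition wave_space :: "('a::euclidean_space) set \<Rightarrow> (('a \<Rightarrow> real) \<times> ('a \<Rightarrow> real)) nspace"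
  where "wave_space G = prod_nspace (H10 G) (L2_dom G)"

definition wave_dom :: "('a::euclidean_space) set \<Rightarrow> (('a \<Rightarrow> real) \<times> ('a \<Rightarrow> real)) set"
  where "wave_dom G = (H2 G \<inter> elts (H10 G)) \<times> elts (H10 G)"

definition wave_op ::
    "('a::euclidean_space) set \<Rightarrow> ('a \<Rightarrow> real) \<times> ('a \<Rightarrow> real) \<Rightarrow> ('a \<Rightarrow> real) \<times> ('a \<Rightarrow> real)"
  where "wave_op G = (\<lambda>(f, g). (g, laplacian G f))"

definition C0_group :: "('v::real_vector) nspace \<Rightarrow> (real \<Rightarrow> 'v \<Rightarrow> 'v) \<Rightarrow> bool"
  where "C0_group X S \<longleftrightarrow>
    (\<forall>t. \<forall>u\<in>elts X. S t u \<in> elts X) \<and>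
    (\<forall>t c. \<forall>u\<in>elts X. \<forall>v\<in>elts X. nrm X (S t (c *\<^sub>R u + v) - (c *\<^sub>R S t u + S t v)) = 0) \<and>
    (\<forall>t. \<exists>C. \<forall>u\<in>elts X. nrm X (S t u) \<le> C * nrm X u) \<and>
    (\<forall>u\<in>elts X. nrm X (S 0 u - u) = 0) \<and>
    (\<forall>s t. \<forall>u\<in>elts X. nrm X (S (s + t) u - S s (S t u)) = 0) \<and>
    (\<forall>u\<in>elts X. ((\<lambda>t. nrm X (S t u - u)) \<longlongrightarrow> 0) (at 0))"

definition generated_by ::
    "('v::real_vector) nspace \<Rightarrow> (real \<Rightarrow> 'v \<Rightarrow> 'v) \<Rightarrow> 'v set \<Rightarrow> ('v \<Rightarrow> 'v) \<Rightarrow> bool"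
  where "generated_by X S D A \<longleftrightarrow> C0_group X S \<and>
    (\<forall>u\<in>elts X. \<forall>v\<in>elts X.
       ((\<lambda>t. nrm X ((1 / t) *\<^sub>R (S t u - u) - v)) \<longlongrightarrow> 0) (at 0)
         \<longleftrightarrow> u \<in> D \<and> nrm X (v - A u) = 0)"

text \<open>\<open>V = \<lambda>(\<lambda>I - \<A>)\<inverse> U\<close> in \<open>H\<^sup>1\<^sub>0 \<times> L\<^sup>2\<close>.\<close>

definition resolvent_approx ::
    "('a::euclidean_space) set \<Rightarrow> real \<Rightarrow> ('a \<Rightarrow> real) \<times> ('a \<Rightarrow> real)
      \<Rightarrow> ('a \<Rightarrow> real) \<times> ('a \<Rightarrow> real) \<Rightarrow> bool"
  where "resolvent_approx G lam U V \<longleftrightarrow> V \<in> wave_dom G \<and>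
    nrm (wave_space G) (lam *\<^sub>R V - wave_op G V - lam *\<^sub>R U) = 0"

section \<open>Brownian motion and spaces of processes\<close>

text \<open>In what follows only the sigma-algebras of the measures \<open>F t\<close> matter; integrals are taken with
  respect to \<open>P\<close>.\<close>

definition natural_filtration :: "'w measure \<Rightarrow> (real \<Rightarrow> 'w \<Rightarrow> real) \<Rightarrow> real \<Rightarrow> 'w measure"
  where "natural_filtration P W t = sigma (space P)
    ({W s -` B \<inter> space P | s B. 0 \<le> s \<and> s \<le> t \<and> B \<in> sets borel} \<union> null_sets P)"

definition brownian_motion :: "'w measure \<Rightarrow> real \<Rightarrow> (real \<Rightarrow> 'w \<Rightarrow> real) \<Rightarrow> bool"
  where "brownian_motion P T W \<longleftrightarrow>
    (\<forall>t\<in>{0..T}. W t \<in> borel_measurable P) \<and>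
    (AE w in P. W 0 w = 0) \<and>
    (AE w in P. continuous_on {0..T} (\<lambda>t. W t w)) \<and>
    (\<forall>s t. 0 \<le> s \<and> s < t \<and> t \<le> T \<longrightarrow>
       distributed P lborel (\<lambda>w. W t w - W s w)
         (\<lambda>x. ennreal (normal_density 0 (sqrt (t - s)) x)) \<and>
       prob_space.indep_set P (sets (natural_filtration P W s))
         {(\<lambda>w. W t w - W s w) -` B \<inter> space P | B. B \<in> sets borel})"

definition E_sq :: "'w measure \<Rightarrow> 'v nspace \<Rightarrow> ('w \<Rightarrow> 'v) \<Rightarrow> ennreal"
  where "E_sq P X \<xi> = (\<integral>\<^sup>+w. ennreal ((nrm X (\<xi> w))\<^sup>2) \<partial>P)"

definition E_int_sq ::
    "'w measure \<Rightarrow> 'v nspace \<Rightarrow> real \<Rightarrow> real \<Rightarrow> (real \<Rightarrow> 'w \<Rightarrow> 'v) \<Rightarrow> ennreal"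
  where "E_int_sq P X a b f =
    (\<integral>\<^sup>+w. (\<integral>\<^sup>+s\<in>{a..b}. ennreal ((nrm X (f s w))\<^sup>2) \<partial>lborel) \<partial>P)"

definition progressive ::
    "(real \<Rightarrow> 'w measure) \<Rightarrow> ('v::real_vector) nspace \<Rightarrow> real \<Rightarrow> real \<Rightarrow> (real \<Rightarrow> 'w \<Rightarrow> 'v) \<Rightarrow> bool"
  where "progressive F X a b f \<longleftrightarrow>
    (\<forall>r\<in>{a..b}. strongly_measurable (restrict_space borel {a..r} \<Otimes>\<^sub>M F r) X (\<lambda>(s, w). f s w))"

text \<open>\<open>L\<^sup>2\<^bsub>M\<^esub>(\<Omega>; X)\<close> for a sub-sigma-algebra \<open>M\<close>.\<close>

definition L2_rv :: "'w measure \<Rightarrow> 'w measure \<Rightarrow> ('v::real_vector) nspace \<Rightarrow> ('w \<Rightarrow> 'v) \<Rightarrow> bool"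
  where "L2_rv P M X \<xi> \<longleftrightarrow> strongly_measurable M X \<xi> \<and> E_sq P X \<xi> < \<infinity>"

text \<open>\<open>L\<^sup>2\<^bsub>F\<^esub>(a, b; X)\<close>\<close>

definition L2_proc :: "'w measure \<Rightarrow> (real \<Rightarrow> 'w measure) \<Rightarrow> ('v::real_vector) nspace
      \<Rightarrow> real \<Rightarrow> real \<Rightarrow> (real \<Rightarrow> 'w \<Rightarrow> 'v) \<Rightarrow> bool"
  where "L2_proc P F X a b f \<longleftrightarrow> progressive F X a b f \<and> E_int_sq P X a b f < \<infinity>"

text \<open>\<open>L\<^sup>2\<^bsub>F\<^esub>(\<Omega>; C([a, b]; X))\<close>\<close>

definition L2_cont_proc :: "'w measure \<Rightarrow> (real \<Rightarrow> 'w measure) \<Rightarrow> ('v::real_vector) nspace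
      \<Rightarrow> real \<Rightarrow> real \<Rightarrow> (real \<Rightarrow> 'w \<Rightarrow> 'v) \<Rightarrow> bool"
  where "L2_cont_proc P F X a b f \<longleftrightarrow> progressive F X a b f \<and>
    (AE w in P. \<forall>t\<in>{a..b}. ((\<lambda>s. nrm X (f s w - f t w)) \<longlongrightarrow> 0) (at t within {a..b})) \<and>
    (\<integral>\<^sup>+w. (SUP t\<in>{a..b}. ennreal ((nrm X (f t w))\<^sup>2)) \<partial>P) < \<infinity>"

text \<open>\<open>C\<^bsub>F\<^esub>([a, b]; L\<^sup>2(\<Omega>; X))\<close>\<close>

definition C_L2_proc :: "'w measure \<Rightarrow> (real \<Rightarrow> 'w measure) \<Rightarrow> ('v::real_vector) nspace
      \<Rightarrow> real \<Rightarrow> real \<Rightarrow> (real \<Rightarrow> 'w \<Rightarrow> 'v) \<Rightarrow> bool"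
  where "C_L2_proc P F X a b f \<longleftrightarrow> progressive F X a b f \<and>
    (\<forall>t\<in>{a..b}. L2_rv P (F b) X (f t) \<and>
       ((\<lambda>s. E_sq P X (\<lambda>w. f s w - f t w)) \<longlongrightarrow> 0) (at t within {a..b}))"

text \<open>\<open>f\<close> belongs to \<open>C\<^sup>1\<^bsub>F\<^esub>([a, b]; L\<^sup>2(\<Omega>; X))\<close> and has the derivative \<open>f'\<close>.\<close>

definition C1_L2_proc :: "'w measure \<Rightarrow> (real \<Rightarrow> 'w measure) \<Rightarrow> ('v::real_vector) nspace
      \<Rightarrow> real \<Rightarrow> real \<Rightarrow> (real \<Rightarrow> 'w \<Rightarrow> 'v) \<Rightarrow> (real \<Rightarrow> 'w \<Rightarrow> 'v) \<Rightarrow> bool"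
  where "C1_L2_proc P F X a b f f' \<longleftrightarrow> C_L2_proc P F X a b f \<and> C_L2_proc P F X a b f' \<and>
    (\<forall>t\<in>{a..b}. ((\<lambda>s. E_sq P X (\<lambda>w. (1 / (s - t)) *\<^sub>R (f s w - f t w) - f' t w)) \<longlongrightarrow> 0)
       (at t within {a..b}))"

text \<open>\<open>L\<^sup>\<infinity>\<^bsub>F\<^esub>(0, T; L\<^sup>\<infinity>(G))\<close>. As \<open>L\<^sup>\<infinity>(G)\<close> is not separable, measurability is joint measurability
  in \<open>(t, \<omega>, x)\<close>, not strong measurability.\<close>

definition Linf_coeff :: "'w measure \<Rightarrow> (real \<Rightarrow> 'w measure) \<Rightarrow> ('a::euclidean_space) set
      \<Rightarrow> real \<Rightarrow> (real \<Rightarrow> 'w \<Rightarrow> 'a \<Rightarrow> real) \<Rightarrow> bool"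
  where "Linf_coeff P F G T a \<longleftrightarrow>
    (\<forall>r\<in>{0..T}. (\<lambda>((s, w), x). a s w x)
       \<in> borel_measurable ((restrict_space borel {0..r} \<Otimes>\<^sub>M F r) \<Otimes>\<^sub>M lebesgue_on G)) \<and>
    (\<exists>C. AE ((s, w), x) in (restrict_space lborel {0..T} \<Otimes>\<^sub>M P) \<Otimes>\<^sub>M lebesgue_on G. \<bar>a s w x\<bar> \<le> C)"

section \<open>The Ito integral\<close>

text \<open>The elementary process with the values \<open>\<xi> j\<close> on \<open>[ts j, ts (j + 1))\<close> for \<open>j < m\<close>, and its
  stochastic integral.\<close>

definition elementary :: "nat \<Rightarrow> (nat \<Rightarrow> real) \<Rightarrow> (nat \<Rightarrow> 'w \<Rightarrow> 'v::real_vector) \<Rightarrow> real \<Rightarrow> 'w \<Rightarrow> 'v"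
  where "elementary m ts \<xi> s w = (\<Sum>j<m. indicator {ts j..<ts (Suc j)} s *\<^sub>R \<xi> j w)"

definition elementary_integral ::
    "(real \<Rightarrow> 'w \<Rightarrow> real) \<Rightarrow> nat \<Rightarrow> (nat \<Rightarrow> real) \<Rightarrow> (nat \<Rightarrow> 'w \<Rightarrow> 'v::real_vector) \<Rightarrow> 'w \<Rightarrow> 'v"
  where "elementary_integral W m ts \<xi> w = (\<Sum>j<m. (W (ts (Suc j)) w - W (ts j) w) *\<^sub>R \<xi> j w)"

definition ito_integral_in :: "'w measure \<Rightarrow> (real \<Rightarrow> 'w measure) \<Rightarrow> (real \<Rightarrow> 'w \<Rightarrow> real)
      \<Rightarrow> ('v::real_vector) nspace \<Rightarrow> real \<Rightarrow> real \<Rightarrow> (real \<Rightarrow> 'w \<Rightarrow> 'v) \<Rightarrow> ('w \<Rightarrow> 'v) \<Rightarrow> bool"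
  where "ito_integral_in P F W X a b f I \<longleftrightarrow>
    L2_proc P F X a b f \<and> L2_rv P (F b) X I \<and>
    (\<exists>(m :: nat \<Rightarrow> nat) (ts :: nat \<Rightarrow> nat \<Rightarrow> real) (\<xi> :: nat \<Rightarrow> nat \<Rightarrow> 'w \<Rightarrow> 'v).
       (\<forall>k. ts k 0 = a \<and> ts k (m k) = b \<and>
          (\<forall>j<m k. ts k j \<le> ts k (Suc j) \<and> L2_rv P (F (ts k j)) X (\<xi> k j))) \<and>
       (\<lambda>k. E_int_sq P X a b (\<lambda>s w. f s w - elementary (m k) (ts k) (\<xi> k) s w)) \<longlonglongrightarrow> 0 \<and>
       (\<lambda>k. E_sq P X (\<lambda>w. elementary_integral W (m k) (ts k) (\<xi> k) w - I w)) \<longlonglongrightarrow> 0)"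

section \<open>The backward equation\<close>

text \<open>The mild form on \<open>H\<^sup>1\<^sub>0 \<times> L\<^sup>2\<close>, where \<open>S\<close> is the group generated by the wave operator:
  for all \<open>t\<close>, almost surely,
  \<open>(z, zh)(t) = S(t - \<tau>) (z\<^sup>\<tau>, zh\<^sup>\<tau>) - \<integral>\<^bsub>t\<^esub>\<^bsup>\<tau>\<^esup> S(t - s) (0, a\<^sub>1 z + a\<^sub>2 Z) ds - \<integral>\<^bsub>t\<^esub>\<^bsup>\<tau>\<^esup> S(t - s) (Z, Zh) dW(s)\<close>.\<close>

definition mild_solution ::
    "'w measure \<Rightarrow> (real \<Rightarrow> 'w measure) \<Rightarrow> (real \<Rightarrow> 'w \<Rightarrow> real) \<Rightarrow> ('a::euclidean_space) set
      \<Rightarrow> (real \<Rightarrow> 'w \<Rightarrow> 'a \<Rightarrow> real) \<Rightarrow> (real \<Rightarrow> 'w \<Rightarrow> 'a \<Rightarrow> real) \<Rightarrow> real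
      \<Rightarrow> ('w \<Rightarrow> 'a \<Rightarrow> real) \<Rightarrow> ('w \<Rightarrow> 'a \<Rightarrow> real)
      \<Rightarrow> (real \<Rightarrow> 'w \<Rightarrow> 'a \<Rightarrow> real) \<Rightarrow> (real \<Rightarrow> 'w \<Rightarrow> 'a \<Rightarrow> real)
      \<Rightarrow> (real \<Rightarrow> 'w \<Rightarrow> 'a \<Rightarrow> real) \<Rightarrow> (real \<Rightarrow> 'w \<Rightarrow> 'a \<Rightarrow> real) \<Rightarrow> bool"
  where "mild_solution P F W G a1 a2 \<tau> z\<tau> zh\<tau> z zh Z Zh \<longleftrightarrow>
    L2_cont_proc P F (H10 G) 0 \<tau> z \<and> L2_cont_proc P F (L2_dom G) 0 \<tau> zh \<and>
    L2_proc P F (H10 G) 0 \<tau> Z \<and> L2_proc P F (L2_dom G) 0 \<tau> Zh \<and>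
    (\<exists>S. generated_by (wave_space G) S (wave_dom G) (wave_op G) \<and>
      (\<forall>t\<in>{0..\<tau>}. \<exists>B I.
         (AE w in P. bochner_integral_in (restrict_space lborel {t..\<tau>}) (wave_space G)
            (\<lambda>s. S (t - s) (0, \<lambda>x. a1 s w x * z s w x + a2 s w x * Z s w x)) (B w)) \<and>
         ito_integral_in P F W (wave_space G) t \<tau> (\<lambda>s w. S (t - s) (Z s w, Zh s w)) I \<and>
         (AE w in P. nrm (wave_space G)
            ((z t w, zh t w) - (S (t - \<tau>) (z\<tau> w, zh\<tau> w) - B w - I w)) = 0)))"

definition normal_deriv_proc ::
    "'w measure \<Rightarrow> (real \<Rightarrow> 'w measure) \<Rightarrow> ('a::euclidean_space) set \<Rightarrow> real
      \<Rightarrow> (real \<Rightarrow> 'w \<Rightarrow> 'a \<Rightarrow> real) \<Rightarrow> (real \<Rightarrow> 'w \<Rightarrow> 'a \<Rightarrow> real)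
      \<Rightarrow> (real \<Rightarrow> 'w \<Rightarrow> 'a \<Rightarrow> real) \<Rightarrow> bool"
  where "normal_deriv_proc P F G \<tau> z zh p \<longleftrightarrow> L2_proc P F (L2_bdry G) 0 \<tau> p \<and>
    (\<exists>q :: real \<Rightarrow> real \<Rightarrow> 'w \<Rightarrow> 'a \<Rightarrow> real.
       (\<forall>\<^sub>F lam in at_top. L2_proc P F (L2_bdry G) 0 \<tau> (q lam) \<and>
          (\<forall>t\<in>{0..\<tau>}. \<forall>w\<in>space P. \<exists>V. resolvent_approx G lam (z t w, zh t w) V \<and>
             is_normal_deriv G (fst V) (q lam t w))) \<and>
       ((\<lambda>lam. E_int_sq P (L2_bdry G) 0 \<tau> (\<lambda>t w. q lam t w - p t w)) \<longlongrightarrow> 0) at_top)"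

section \<open>The controlled equation\<close>

text \<open>The processes \<open>y\<close> and \<open>yt\<close> are the solution and its time derivative. The pairing of \<open>H\<^sup>-\<^sup>1\<close> and
  \<open>H\<^sup>1\<^sub>0\<close> is function application. Since \<open>z(0)\<close> and \<open>zh(0)\<close> are measurable with respect to the trivial
  sigma-algebra \<open>F 0\<close>, taking the expectation of the two terms at time 0 only removes the dependence
  on the representative.\<close>

definition transposition_solution ::
    "'w measure \<Rightarrow> (real \<Rightarrow> 'w measure) \<Rightarrow> (real \<Rightarrow> 'w \<Rightarrow> real) \<Rightarrow> ('a::euclidean_space) set
      \<Rightarrow> real \<Rightarrow> (real \<Rightarrow> 'w \<Rightarrow> 'a \<Rightarrow> real) \<Rightarrow> (real \<Rightarrow> 'w \<Rightarrow> 'a \<Rightarrow> real)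
      \<Rightarrow> ('a \<Rightarrow> real) \<Rightarrow> (('a \<Rightarrow> real) \<Rightarrow> real)
      \<Rightarrow> (real \<Rightarrow> 'w \<Rightarrow> ('a \<Rightarrow> real) \<Rightarrow> real) \<Rightarrow> (real \<Rightarrow> 'w \<Rightarrow> ('a \<Rightarrow> real) \<Rightarrow> real)
      \<Rightarrow> (real \<Rightarrow> 'w \<Rightarrow> 'a \<Rightarrow> real)
      \<Rightarrow> (real \<Rightarrow> 'w \<Rightarrow> 'a \<Rightarrow> real) \<Rightarrow> (real \<Rightarrow> 'w \<Rightarrow> ('a \<Rightarrow> real) \<Rightarrow> real) \<Rightarrow> bool"
  where "transposition_solution P F W G T a1 a2 y0 y1 g1 g2 h y yt \<longleftrightarrow>
    C_L2_proc P F (L2_dom G) 0 T y \<and>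
    C1_L2_proc P F (Hm1 G) 0 T (\<lambda>t w. L2_to_Hm1 G (y t w)) yt \<and>
    (\<forall>\<tau>. 0 < \<tau> \<and> \<tau> \<le> T \<longrightarrow>
      (\<forall>z\<tau> zh\<tau> z zh Z Zh p.
         L2_rv P (F \<tau>) (H10 G) z\<tau> \<and> L2_rv P (F \<tau>) (L2_dom G) zh\<tau> \<and>
         mild_solution P F W G a1 a2 \<tau> z\<tau> zh\<tau> z zh Z Zh \<and>
         normal_deriv_proc P F G \<tau> z zh p \<longrightarrow>
         (\<integral>w. yt \<tau> w (z\<tau> w) \<partial>P) - (\<integral>w. y1 (z 0 w) \<partial>P)
           - (\<integral>w. (\<integral>x. y \<tau> w x * zh\<tau> w x \<partial>lebesgue_on G) \<partial>P)
           + (\<integral>w. (\<integral>x. y0 x * zh 0 w x \<partial>lebesgue_on G) \<partial>P)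
         = (\<integral>w. (LINT t:{0..\<tau>}|lborel. g1 t w (z t w)) \<partial>P)
           + (\<integral>w. (LINT t:{0..\<tau>}|lborel. g2 t w (Z t w)) \<partial>P)
           - (\<integral>w. (LINT t:{0..\<tau>}|lborel. (\<integral>x. p t w x * h t w x \<partial>surface_measure G)) \<partial>P)))"

definition exactly_controllable ::
    "'w measure \<Rightarrow> (real \<Rightarrow> 'w measure) \<Rightarrow> (real \<Rightarrow> 'w \<Rightarrow> real) \<Rightarrow> ('a::euclidean_space) set
      \<Rightarrow> real \<Rightarrow> (real \<Rightarrow> 'w \<Rightarrow> 'a \<Rightarrow> real) \<Rightarrow> (real \<Rightarrow> 'w \<Rightarrow> 'a \<Rightarrow> real) \<Rightarrow> bool"
  where "exactly_controllable P F W G T a1 a2 \<longleftrightarrow>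
    (\<forall>y0\<in>elts (L2_dom G). \<forall>y1\<in>elts (Hm1 G). \<forall>yT0 yT1.
       L2_rv P (F T) (L2_dom G) yT0 \<and> L2_rv P (F T) (Hm1 G) yT1 \<longrightarrow>
       (\<exists>g1 g2 h y yt.
          L2_proc P F (Hm1 G) 0 T g1 \<and> L2_proc P F (Hm1 G) 0 T g2 \<and>
          L2_proc P F (L2_bdry G) 0 T h \<and>
          transposition_solution P F W G T a1 a2 y0 y1 g1 g2 h y yt \<and>
          (AE w in P. nrm (L2_dom G) (y T w - yT0 w) = 0 \<and> nrm (Hm1 G) (yt T w - yT1 w) = 0)))"

end

theory Submission
  imports Defs
begin

text \<open>
  The obstruction is that \<open>y\<close> satisfies \<open>dy = y\<^sub>t dt\<close>, without a stochastic integral: as a process with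
  values in \<open>L\<^sup>2(\<Omega>; H\<^sup>-\<^sup>1)\<close> it is differentiable at the final time \<open>T\<close>, whatever the controls are. Hence
  \<open>y(s)\<close> predicts \<open>y(T)\<close> at time \<open>s\<close> with a mean square error of order \<open>(T - s)\<^sup>2\<close>. The target
  \<open>W(T) v\<close>, with a nonzero \<open>v \<in> H\<^sup>1\<^sub>0\<close>, cannot be predicted that well.

  Pair the solution with \<open>v\<close>. The scalar process \<open>Y(s) = \<langle>y(s), v\<rangle>\<close> is adapted, and
  differentiability at \<open>T\<close> gives \<open>E |Y(s) - Y(T)|\<^sup>2 \<le> K (T - s)\<^sup>2\<close> for \<open>s\<close> close to \<open>T\<close>
  (\<open>C1_L2_proc_final_rate\<close>). If \<open>y(T) = W(T) v\<close>, then \<open>Y(T) = c W(T)\<close> with \<open>c = \<parallel>v\<parallel>\<^sup>2 > 0\<close> in \<open>L\<^sup>2\<close>. Since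
  \<open>W(T) - W(s)\<close> is centred with variance \<open>T - s\<close> and independent of the past up to time \<open>s\<close>, every
  random variable \<open>Y(s)\<close> that is measurable with respect to this past satisfies
  \<open>E |Y(s) - c W(T)|\<^sup>2 \<ge> c\<^sup>2 (T - s)\<close> (\<open>brownian_approximation_error\<close>). The two bounds contradict each
  other as \<open>s\<close> tends to \<open>T\<close>.

  The analytic part of the proof provides the element \<open>v\<close> (\<open>exists_unit_H10\<close>). A test function has to
  be shown to lie in \<open>H\<^sup>1\<^sub>0\<close>; its classical derivatives are weak derivatives by integration by parts
  (\<open>is_weak_deriv_test_function\<close>), and as the norm of \<open>H\<^sup>1\<close> is computed from weak derivatives selected
  by a choice operator, one needs their uniqueness almost everywhere (\<open>nrm_weak_deriv_eq\<close>). Uniqueness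
  is the fundamental lemma of the calculus of variations (\<open>AE_eq_0_if_test_integrals_eq_0\<close>), for which
  smooth bumps that increase to the indicator of a box are constructed explicitly.
\<close>

section \<open>Smooth bump functions\<close>

text \<open>The smooth function \<open>exp (- 1 / t)\<close>, extended by 0, divided by powers of \<open>t\<close>. The powers are included
  because this family is closed under differentiation up to linear combinations.\<close>

definition flat_exp :: "nat \<Rightarrow> real \<Rightarrow> real"
  where "flat_exp m t = (if t > 0 then exp (- (1 / t)) / t ^ m else 0)"

lemma tendsto_flat_exp_0: "(flat_exp m \<longlongrightarrow> 0) (at 0)"
proof -
  have "((\<lambda>t::real. (1 / t) ^ m / exp (1 / t)) \<longlongrightarrow> 0) (at_right 0)"
    using filterlim_compose[OF tendsto_power_div_exp_0 filterlim_inverse_at_top_right, of m]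
    by (simp add: inverse_eq_divide)
  moreover have "\<forall>\<^sub>F t in at_right 0. (1 / t) ^ m / exp (1 / t) = flat_exp m t"
    by (rule eventually_at_rightI[of 0 1])
      (auto simp: flat_exp_def exp_minus field_simps)
  ultimately have right: "(flat_exp m \<longlongrightarrow> 0) (at_right 0)"
    by (rule Lim_transform_eventually)
  have "\<forall>\<^sub>F t in at_left 0. 0 = flat_exp m t"
    by (rule eventually_at_leftI[of "-1" 0]) (auto simp: flat_exp_def)
  then have left: "(flat_exp m \<longlongrightarrow> 0) (at_left 0)"
    by (rule Lim_transform_eventually[rotated]) simp
  show ?thesis
    using left right by (rule filterlim_split_at)
qed

lemma DERIV_flat_exp:
  "(flat_exp m has_real_derivative flat_exp (m + 2) t - real m * flat_exp (m + 1) t) (at t)"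
proof (cases t "0::real" rule: linorder_cases)
  case less
  have "((\<lambda>_. 0) has_real_derivative 0) (at t)"
    by simp
  then have "(flat_exp m has_real_derivative 0) (at t)"
    by (rule has_field_derivative_transform_within_open[of _ _ _ "{..<0}"])
      (use less in \<open>auto simp: flat_exp_def\<close>)
  with less show ?thesis
    by (simp add: flat_exp_def)
next
  case equal
  have "\<forall>\<^sub>F h in at 0. flat_exp (m + 1) h = (flat_exp m (0 + h) - flat_exp m 0) / h"
    by (auto simp: flat_exp_def eventually_at_filter)
  then have "((\<lambda>h. (flat_exp m (0 + h) - flat_exp m 0) / h) \<longlongrightarrow> 0) (at 0)"
    by (rule Lim_transform_eventually[OF tendsto_flat_exp_0])
  with equal show ?thesis
    by (simp add: DERIV_def flat_exp_def)
next
  case greater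
  have "((\<lambda>t. exp (- (1 / t)) / t ^ m) has_real_derivative
      flat_exp (m + 2) t - real m * flat_exp (m + 1) t) (at t)"
  proof -
    have "((\<lambda>t::real. exp (- (1 / t))) has_real_derivative exp (- (1 / t)) / t\<^sup>2) (at t)"
      using greater by (auto intro!: derivative_eq_intros simp: power2_eq_square)
    moreover have "((\<lambda>t. t ^ m) has_real_derivative real m * t ^ m / t) (at t)"
      using DERIV_pow[of m t] greater by (cases m) auto
    ultimately have "((\<lambda>t. exp (- (1 / t)) / t ^ m) has_real_derivative
        (exp (- (1 / t)) / t\<^sup>2 * t ^ m - exp (- (1 / t)) * (real m * t ^ m / t)) / (t ^ m * t ^ m)) (at t)"
      by (rule DERIV_divide) (use greater in simp)
    also have "(exp (- (1 / t)) / t\<^sup>2 * t ^ m - exp (- (1 / t)) * (real m * t ^ m / t)) / (t ^ m * t ^ m)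
        = flat_exp (m + 2) t - real m * flat_exp (m + 1) t"
      using greater by (simp add: flat_exp_def power2_eq_square field_simps)
    finally show ?thesis .
  qed
  then show ?thesis
    by (rule has_field_derivative_transform_within_open[of _ _ _ "{0<..}"])
      (use greater in \<open>auto simp: flat_exp_def\<close>)
qed

text \<open>Smoothness requires all iterated partial derivatives to exist. It comes for free on a class of
  differentiable functions that contains the partial derivatives of its members. Sums and products of
  one-dimensional profiles suffice for bumps supported in boxes.\<close>

inductive_set flat_algebra :: "('a::euclidean_space \<Rightarrow> real) set" where
  const: "(\<lambda>_. c) \<in> flat_algebra"
| flat: "(\<lambda>x. flat_exp m (k * (x \<bullet> e) + c)) \<in> flat_algebra"
| add: "f \<in> flat_algebra \<Longrightarrow> g \<in> flat_algebra \<Longrightarrow> (\<lambda>x. f x + g x) \<in> flat_algebra"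
| mult: "f \<in> flat_algebra \<Longrightarrow> g \<in> flat_algebra \<Longrightarrow> (\<lambda>x. f x * g x) \<in> flat_algebra"

lemma flat_algebra_cmult: "f \<in> flat_algebra \<Longrightarrow> (\<lambda>x. c * f x) \<in> flat_algebra"
  by (intro flat_algebra.mult flat_algebra.const)

lemma flat_algebra_prod:
  assumes "finite A" "\<And>i. i \<in> A \<Longrightarrow> f i \<in> flat_algebra"
  shows "(\<lambda>x. \<Prod>i\<in>A. f i x) \<in> flat_algebra"
  using assms by (induction A rule: finite_induct) (auto intro: flat_algebra.intros)

lemma flat_algebra_has_derivative:
  assumes "f \<in> flat_algebra"
  shows "\<exists>D. (\<forall>x. (f has_derivative (\<lambda>h. D h x)) (at x)) \<and> (\<forall>h. D h \<in> flat_algebra)"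
  using assms
proof induction
  case (const c)
  show ?case
    by (rule exI[of _ "\<lambda>_ _. 0"]) (auto intro: flat_algebra.intros)
next
  case (flat m k e c)
  define D where "D h x = (k * (h \<bullet> e)) * (flat_exp (m + 2) (k * (x \<bullet> e) + c)
    + (- real m) * flat_exp (m + 1) (k * (x \<bullet> e) + c))" for h x :: 'a
  have "((\<lambda>x. flat_exp m (k * (x \<bullet> e) + c)) has_derivative (\<lambda>h. D h x)) (at x)" for x
    unfolding D_def
    by (rule has_derivative_eq_rhs,
        rule DERIV_flat_exp[THEN DERIV_compose_FDERIV])
      (auto intro!: derivative_eq_intros simp: fun_eq_iff algebra_simps)
  moreover have "D h \<in> flat_algebra" for h
    unfolding D_def by (intro flat_algebra_cmult flat_algebra.add flat_algebra.flat)
  ultimately show ?case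
    by blast
next
  case (add f g)
  then obtain D E where DE:
    "\<forall>x. (f has_derivative (\<lambda>h. D h x)) (at x)" "\<forall>h. D h \<in> flat_algebra"
    "\<forall>x. (g has_derivative (\<lambda>h. E h x)) (at x)" "\<forall>h. E h \<in> flat_algebra"
    by blast
  show ?case
    by (rule exI[of _ "\<lambda>h x. D h x + E h x"])
      (use DE in \<open>auto intro!: derivative_eq_intros flat_algebra.intros\<close>)
next
  case (mult f g)
  then obtain D E where DE:
    "\<forall>x. (f has_derivative (\<lambda>h. D h x)) (at x)" "\<forall>h. D h \<in> flat_algebra"
    "\<forall>x. (g has_derivative (\<lambda>h. E h x)) (at x)" "\<forall>h. E h \<in> flat_algebra"
    by blast
  show ?case
    by (rule exI[of _ "\<lambda>h x. f x * E h x + D h x * g x"])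
      (use DE mult.hyps in \<open>auto intro!: derivative_eq_intros flat_algebra.intros\<close>)
qed

lemma iter_partial_flat_algebra:
  assumes "f \<in> flat_algebra"
  shows "iter_partial bs f \<in> flat_algebra"
proof (induction bs)
  case Nil
  with assms show ?case by simp
next
  case (Cons b bs)
  obtain D where D: "\<forall>x. (iter_partial bs f has_derivative (\<lambda>h. D h x)) (at x)"
      "\<forall>h. D h \<in> flat_algebra"
    using flat_algebra_has_derivative[OF Cons.IH] by blast
  then have "frechet_derivative (iter_partial bs f) (at x) = (\<lambda>h. D h x)" for x
    by (metis frechet_derivative_at)
  with D show ?case
    by simp
qed

lemma smooth_on_flat_algebra: "f \<in> flat_algebra \<Longrightarrow> smooth_on UNIV f"
  unfolding smooth_on_def
  by (auto simp: differentiable_on_def)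
    (metis iter_partial_flat_algebra flat_algebra_has_derivative differentiable_def)

text \<open>For \<open>k > 0\<close> this bump is positive exactly on the open box. Since \<open>flat_exp 0 (k t)\<close> is the \<open>k\<close>-th
  root of \<open>flat_exp 0 t\<close>, the bump is the \<open>k\<close>-th root of the one with \<open>k = 1\<close>, so for large \<open>k\<close> it
  approaches the indicator of the box.\<close>

definition box_bump :: "real \<Rightarrow> 'a \<Rightarrow> 'a \<Rightarrow> 'a::euclidean_space \<Rightarrow> real"
  where "box_bump k a b x =
    (\<Prod>i\<in>Basis. flat_exp 0 (k * (x \<bullet> i) + - k * (a \<bullet> i)) * flat_exp 0 (- k * (x \<bullet> i) + k * (b \<bullet> i)))"

lemma box_bump_eq:
  assumes "k > 0"
  shows "box_bump k a b x = (if x \<in> box a b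
    then \<Prod>i\<in>Basis. exp (- (1 / (k * (x \<bullet> i - a \<bullet> i)))) * exp (- (1 / (k * (b \<bullet> i - x \<bullet> i)))) else 0)"
proof (cases "x \<in> box a b")
  case True
  with assms show ?thesis
    by (auto simp: box_bump_def flat_exp_def mem_box algebra_simps intro!: prod.cong)
next
  case False
  then obtain i where i: "i \<in> Basis" "\<not> (a \<bullet> i < x \<bullet> i \<and> x \<bullet> i < b \<bullet> i)"
    by (auto simp: mem_box)
  with assms have "\<exists>i\<in>Basis. flat_exp 0 (k * (x \<bullet> i) + - k * (a \<bullet> i)) * flat_exp 0 (- k * (x \<bullet> i) + k * (b \<bullet> i)) = 0"
    by (intro bexI[of _ i]) (auto simp: flat_exp_def not_less)
  then have "box_bump k a b x = 0"
    unfolding box_bump_def by (subst prod_zero_iff) auto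
  with False show ?thesis by simp
qed

lemma box_bump_test_function:
  assumes "k > 0" "cbox a b \<subseteq> G"
  shows "(\<lambda>x. c * box_bump k a b x) \<in> test_functions G"
proof -
  have "(\<lambda>x. c * box_bump k a b x) \<in> flat_algebra"
    unfolding box_bump_def
    by (intro flat_algebra_cmult flat_algebra_prod flat_algebra.mult flat_algebra.flat finite_Basis)
  then have smooth: "smooth_on UNIV (\<lambda>x. c * box_bump k a b x)"
    by (rule smooth_on_flat_algebra)
  have "{x. c * box_bump k a b x \<noteq> 0} \<subseteq> cbox a b"
    using assms(1) box_subset_cbox[of a b] by (auto simp: box_bump_eq split: if_splits)
  then have sub: "closure {x. c * box_bump k a b x \<noteq> 0} \<subseteq> cbox a b"
    by (rule closure_minimal) (rule closed_cbox)
  then have "compact (closure {x. c * box_bump k a b x \<noteq> 0})"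
    by (meson bounded_cbox bounded_subset closed_closure compact_eq_bounded_closed)
  with smooth sub assms(2) show ?thesis
    by (auto simp: test_functions_def)
qed

lemma box_bump_bounded:
  assumes "k > 0"
  shows "0 \<le> box_bump k a b x" "box_bump k a b x \<le> 1"
proof -
  show "0 \<le> box_bump k a b x"
    using assms by (auto simp: box_bump_eq intro!: prod_nonneg)
  show "box_bump k a b x \<le> 1"
    using assms by (auto simp: box_bump_eq mem_box intro!: prod_le_1 mult_le_one)
qed

lemma box_bump_tendsto_indicator:
  "(\<lambda>k. box_bump (real (Suc k)) a b x) \<longlonglongrightarrow> indicator (box a b) x"
proof (cases "x \<in> box a b")
  case True
  have lim: "(\<lambda>k. exp (- (1 / (real (Suc k) * d)))) \<longlonglongrightarrow> 1" for d :: real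
  proof -
    have "(\<lambda>k. exp (- (inverse (real (Suc k)) * inverse d))) \<longlonglongrightarrow> exp (- (0 * inverse d))"
      by (intro tendsto_intros LIMSEQ_inverse_real_of_nat)
    then show ?thesis
      by (simp add: divide_inverse)
  qed
  have "(\<lambda>k. \<Prod>i\<in>Basis. exp (- (1 / (real (Suc k) * (x \<bullet> i - a \<bullet> i))))
      * exp (- (1 / (real (Suc k) * (b \<bullet> i - x \<bullet> i))))) \<longlonglongrightarrow> (\<Prod>i\<in>(Basis :: 'a set). 1 * 1)"
    by (intro tendsto_prod tendsto_mult lim)
  with True show ?thesis
    by (simp add: box_bump_eq)
next
  case False
  then show ?thesis
    by (simp add: box_bump_eq)
qed


section \<open>Weak derivatives\<close>

lemma test_functionD:
  fixes \<phi> :: "'a::euclidean_space \<Rightarrow> real"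
  assumes "\<phi> \<in> test_functions G"
  shows "\<phi> differentiable (at x)"
    and "continuous_on UNIV \<phi>"
    and "b \<in> Basis \<Longrightarrow> continuous_on UNIV (\<lambda>x. frechet_derivative \<phi> (at x) b)"
    and "\<exists>K. compact K \<and> K \<subseteq> G \<and> (\<forall>x. x \<notin> K \<longrightarrow> \<phi> x = 0)"
proof -
  have smooth: "\<And>bs. bs \<in> lists Basis \<Longrightarrow> iter_partial bs \<phi> differentiable_on UNIV"
    using assms by (auto simp: test_functions_def smooth_on_def)
  show diff: "\<phi> differentiable (at x)" for x
    using smooth[of "[]"] by (simp add: differentiable_on_def)
  then show "continuous_on UNIV \<phi>"
    by (simp add: continuous_on_eq_continuous_within differentiable_imp_continuous_within)
  show "continuous_on UNIV (\<lambda>x. frechet_derivative \<phi> (at x) b)" if "b \<in> Basis"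
    using smooth[of "[b]"] that by (simp add: differentiable_imp_continuous_on)
  show "\<exists>K. compact K \<and> K \<subseteq> G \<and> (\<forall>x. x \<notin> K \<longrightarrow> \<phi> x = 0)"
    using assms closure_subset[of "{x. \<phi> x \<noteq> 0}"]
    by (intro exI[of _ "closure {x. \<phi> x \<noteq> 0}"]) (auto simp: test_functions_def)
qed

lemma frechet_derivative_eq_0_outside:
  fixes F :: "'a::euclidean_space \<Rightarrow> real"
  assumes "closed K" "\<And>x. x \<notin> K \<Longrightarrow> F x = 0" "x \<notin> K"
  shows "frechet_derivative F (at x) b = 0"
proof -
  have "((\<lambda>_. 0) has_derivative (\<lambda>_. 0)) (at x)"
    by simp
  then have "(F has_derivative (\<lambda>_. 0)) (at x)"
    by (rule has_derivative_transform_within_open[of _ _ _ _ "- K"]) (use assms in auto)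
  then show ?thesis
    using frechet_derivative_at by metis
qed

lemma continuous_compact_support_bounded:
  fixes f :: "'a::euclidean_space \<Rightarrow> real"
  assumes "continuous_on UNIV f" "compact K" "\<And>x. x \<notin> K \<Longrightarrow> f x = 0"
  obtains M where "M \<ge> 0" "\<And>x. \<bar>f x\<bar> \<le> M"
proof -
  have "compact (f ` K)"
    using assms by (intro compact_continuous_image) (auto intro: continuous_on_subset)
  then obtain M where M: "\<And>x. x \<in> K \<Longrightarrow> \<bar>f x\<bar> \<le> M"
    by (metis bounded_iff compact_imp_bounded imageI real_norm_def)
  show ?thesis
  proof (rule that[of "max M 0"])
    show "\<bar>f x\<bar> \<le> max M 0" for x
      using M[of x] assms(3)[of x] by (cases "x \<in> K") auto
  qed simp
qed

lemma integrable_continuous_compact_support: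
  fixes f :: "'a::euclidean_space \<Rightarrow> real"
  assumes "continuous_on UNIV f" "compact K" "\<And>x. x \<notin> K \<Longrightarrow> f x = 0"
  shows "integrable lborel f"
proof -
  have "integrable lborel (\<lambda>x. indicator K x *\<^sub>R f x)"
    using assms borel_integrable_compact[of K f] continuous_on_subset[of UNIV f K]
    by (auto simp: indicator_scaleR_eq_if)
  also have "(\<lambda>x. indicator K x *\<^sub>R f x) = f"
    using assms(3) by (auto simp: fun_eq_iff indicator_def)
  finally show ?thesis .
qed

lemma integral_lborel_translate:
  fixes f :: "'a::euclidean_space \<Rightarrow> real"
  assumes "f \<in> borel_measurable borel"
  shows "(\<integral>x. f (x + a) \<partial>lborel) = (\<integral>x. f x \<partial>lborel)"
proof -
  have "(\<integral>x. f x \<partial>lborel) = (\<integral>x. f x \<partial>distr lborel borel ((+) a))"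
    by (simp add: lborel_distr_plus)
  also have "\<dots> = (\<integral>x. f (x + a) \<partial>lborel)"
    using assms by (subst integral_distr) (auto simp: add.commute)
  finally show ?thesis by simp
qed

text \<open>By translation invariance of Lebesgue measure, the difference quotients of \<open>F\<close> in direction \<open>b\<close> have
  integral 0. By the mean value theorem they are dominated by a multiple of the indicator of a ball, so
  the integral of their limit, the derivative, is 0 as well.\<close>

lemma integral_partial_derivative_eq_0:
  fixes F :: "'a::euclidean_space \<Rightarrow> real"
  assumes diff: "\<And>x. F differentiable (at x)"
    and cont: "continuous_on UNIV (\<lambda>x. frechet_derivative F (at x) b)"
    and K: "compact K" and F0: "\<And>x. x \<notin> K \<Longrightarrow> F x = 0"
  shows "(\<integral>x. frechet_derivative F (at x) b \<partial>lborel) = 0"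
proof -
  define D where "D x = frechet_derivative F (at x) b" for x
  have contF: "continuous_on UNIV F"
    using diff by (simp add: continuous_on_eq_continuous_within differentiable_imp_continuous_within)
  have [measurable]: "F \<in> borel_measurable borel" "D \<in> borel_measurable borel"
    using contF cont unfolding D_def by (auto intro: borel_measurable_continuous_onI)
  have D0: "D x = 0" if "x \<notin> K" for x
    unfolding D_def using that frechet_derivative_eq_0_outside[OF compact_imp_closed[OF K]] F0 by blast
  obtain M where M: "M \<ge> 0" "\<And>x. \<bar>D x\<bar> \<le> M"
    using continuous_compact_support_bounded[of D, OF _ K D0] cont unfolding D_def by blast
  have line: "((\<lambda>t. F (x + t *\<^sub>R b)) has_real_derivative D (x + t *\<^sub>R b)) (at t)" for x t
  proof -
    have "(F has_derivative frechet_derivative F (at (x + t *\<^sub>R b))) (at (x + t *\<^sub>R b))"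
      using diff frechet_derivative_works by blast
    then have "((\<lambda>t. F (x + t *\<^sub>R b)) has_derivative
        (\<lambda>h. frechet_derivative F (at (x + t *\<^sub>R b)) (h *\<^sub>R b))) (at t)"
      by (rule has_derivative_compose[rotated]) (auto intro!: derivative_eq_intros)
    moreover have "linear (frechet_derivative F (at (x + t *\<^sub>R b)))"
      using diff linear_frechet_derivative by blast
    ultimately show ?thesis
      by (simp add: has_field_derivative_def D_def linear_cmul mult.commute[of _ "frechet_derivative _ _ _"])
  qed
  define t where "t n = inverse (real (Suc n))" for n
  have t: "0 < t n" "t n \<le> 1" for n
    by (auto simp: t_def field_simps)
  define q where "q n x = (F (x + t n *\<^sub>R b) - F x) / t n" for n x
  have [measurable]: "q n \<in> borel_measurable borel" for n
    unfolding q_def by measurable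
  \<comment> \<open>All steps \<open>t n\<close> are at most 1, so the translates of \<open>K\<close> stay in a ball enlarged by \<open>norm b\<close>.\<close>
  obtain R where R: "\<And>x. x \<in> K \<Longrightarrow> norm x \<le> R"
    using compact_imp_bounded[OF K] by (auto simp: bounded_iff)
  define S where "S = cball (0::'a) (R + norm b)"
  have bound: "\<bar>q n x\<bar> \<le> indicator S x *\<^sub>R M" for n x
  proof (cases "x \<in> S")
    case True
    obtain z where "F (x + t n *\<^sub>R b) - F (x + 0 *\<^sub>R b) = (t n - 0) * D (x + z *\<^sub>R b)"
      using MVT2[of 0 "t n" "\<lambda>t. F (x + t *\<^sub>R b)" "\<lambda>t. D (x + t *\<^sub>R b)"] t line by blast
    then have "q n x = D (x + z *\<^sub>R b)"
      using t[of n] by (simp add: q_def)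
    with True M show ?thesis by simp
  next
    case False
    then have far: "norm x > R + norm b"
      by (simp add: S_def)
    have "norm (t n *\<^sub>R b) \<le> norm b"
      using t[of n] by (simp add: mult_left_le_one_le)
    with far have "norm (x + t n *\<^sub>R b) > R" "norm x > R"
      using norm_triangle_ineq4[of "x + t n *\<^sub>R b" "t n *\<^sub>R b"] norm_ge_zero[of b]
      unfolding add_diff_cancel_right' by linarith+
    then have "F (x + t n *\<^sub>R b) = 0" "F x = 0"
      using F0 R by force+
    with False show ?thesis by (simp add: q_def)
  qed
  have "(\<lambda>n. q n x) \<longlonglongrightarrow> D x" for x
  proof -
    have "((\<lambda>h. (F (x + h *\<^sub>R b) - F x) / h) \<longlongrightarrow> D x) (at 0)"
      using line[of x 0] by (simp add: DERIV_def)
    moreover have "filterlim t (at 0) sequentially"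
      unfolding filterlim_at t_def using LIMSEQ_inverse_real_of_nat by auto
    ultimately show ?thesis
      unfolding q_def by (rule filterlim_compose)
  qed
  then have "(\<lambda>n. \<integral>x. q n x \<partial>lborel) \<longlonglongrightarrow> (\<integral>x. D x \<partial>lborel)"
    by (intro integral_dominated_convergence[where w = "\<lambda>x. indicator S x *\<^sub>R M"])
      (use bound borel_integrable_compact[of S "\<lambda>_. M"] in \<open>auto simp: S_def indicator_scaleR_eq_if\<close>)
  moreover have "(\<integral>x. q n x \<partial>lborel) = 0" for n
  proof -
    have F: "integrable lborel F"
      using integrable_continuous_compact_support[OF contF K F0] .
    have Ft: "integrable lborel (\<lambda>x. F (x + t n *\<^sub>R b))"
    proof (rule integrable_continuous_compact_support)
      show "continuous_on UNIV (\<lambda>x. F (x + t n *\<^sub>R b))"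
        by (intro continuous_on_compose2[OF contF] continuous_intros) auto
      show "compact ((\<lambda>x. x - t n *\<^sub>R b) ` K)"
        using K by (intro compact_continuous_image continuous_intros)
      show "F (x + t n *\<^sub>R b) = 0" if "x \<notin> (\<lambda>x. x - t n *\<^sub>R b) ` K" for x
        using that by (intro F0) (auto simp: image_iff)
    qed
    show ?thesis
      unfolding q_def using F Ft integral_lborel_translate[of F "t n *\<^sub>R b"] by simp
  qed
  ultimately have "(\<lambda>_::nat. 0) \<longlonglongrightarrow> (\<integral>x. D x \<partial>lborel)"
    by simp
  then show ?thesis
    unfolding D_def by (rule LIMSEQ_unique[OF _ tendsto_const])
qed

lemma integral_lebesgue_on_eq_lborel:
  fixes f :: "'a::euclidean_space \<Rightarrow> real"
  assumes "open G" "f \<in> borel_measurable borel" "\<And>x. x \<notin> G \<Longrightarrow> f x = 0"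
  shows "(\<integral>x. f x \<partial>lebesgue_on G) = (\<integral>x. f x \<partial>lborel)"
proof -
  have "(\<integral>x. f x \<partial>lebesgue_on G) = (\<integral>x. indicator G x *\<^sub>R f x \<partial>lebesgue)"
    using assms(1) by (intro integral_restrict_space) auto
  also have "(\<lambda>x. indicator G x *\<^sub>R f x) = f"
    using assms(3) by (auto simp: fun_eq_iff indicator_def)
  finally show ?thesis
    using assms(2) by (simp add: integral_completion)
qed

lemma continuous_compact_support_in_L2_dom:
  fixes f :: "'a::euclidean_space \<Rightarrow> real"
  assumes "open G" "continuous_on UNIV f" "compact K" "\<And>x. x \<notin> K \<Longrightarrow> f x = 0"
  shows "f \<in> elts (L2_dom G)"
proof -
  have f[measurable]: "f \<in> borel_measurable borel"
    using assms(2) by (rule borel_measurable_continuous_onI)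
  have "integrable lborel (\<lambda>x. (f x)\<^sup>2)"
    by (rule integrable_continuous_compact_support[OF _ assms(3)])
      (use assms in \<open>auto intro!: continuous_intros\<close>)
  then have "integrable lebesgue (\<lambda>x. (f x)\<^sup>2)"
    by (simp add: integrable_completion)
  then have "integrable (lebesgue_on G) (\<lambda>x. (f x)\<^sup>2)"
    using integrable_mult_indicator[of G lebesgue "\<lambda>x. (f x)\<^sup>2"] assms(1)
    by (subst integrable_restrict_space) auto
  then show ?thesis
    by (auto simp: L2_def intro!: measurable_restrict_space1 measurable_completion)
qed

text \<open>Integration by parts: the product of two test functions has compact support, so the integral of its
  partial derivative vanishes.\<close>

lemma is_weak_deriv_test_function:
  fixes \<phi> :: "'a::euclidean_space \<Rightarrow> real"
  assumes G: "open G" and \<phi>: "\<phi> \<in> test_functions G" and b: "b \<in> Basis"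
  shows "is_weak_deriv G b \<phi> (\<lambda>x. frechet_derivative \<phi> (at x) b)"
  unfolding is_weak_deriv_def
proof (intro conjI ballI)
  obtain K where K: "compact K" "K \<subseteq> G" "\<And>x. x \<notin> K \<Longrightarrow> \<phi> x = 0"
    using test_functionD(4)[OF \<phi>] by blast
  have D0: "frechet_derivative \<phi> (at x) b = 0" if "x \<notin> K" for x
    using frechet_derivative_eq_0_outside[OF compact_imp_closed[OF K(1)] K(3) that] .
  note cont = test_functionD(2,3)[OF \<phi>]
  show "(\<lambda>x. frechet_derivative \<phi> (at x) b) \<in> elts (L2_dom G)"
    using continuous_compact_support_in_L2_dom[OF G cont(2)[OF b] K(1) D0] .
  fix \<psi> assume \<psi>: "\<psi> \<in> test_functions G"
  note cont' = test_functionD(2,3)[OF \<psi>]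
  define D1 where "D1 x = \<phi> x * frechet_derivative \<psi> (at x) b" for x
  define D2 where "D2 x = frechet_derivative \<phi> (at x) b * \<psi> x" for x
  have prod: "((\<lambda>x. \<phi> x * \<psi> x) has_derivative
      (\<lambda>h. \<phi> x * frechet_derivative \<psi> (at x) h + frechet_derivative \<phi> (at x) h * \<psi> x)) (at x)" for x
    using test_functionD(1)[OF \<phi>] test_functionD(1)[OF \<psi>]
    by (intro has_derivative_mult) (simp_all add: frechet_derivative_works[symmetric])
  then have D: "frechet_derivative (\<lambda>x. \<phi> x * \<psi> x) (at x) b = D1 x + D2 x" for x
    using frechet_derivative_at[OF prod[of x], symmetric] by (simp add: D1_def D2_def)
  have c: "continuous_on UNIV D1" "continuous_on UNIV D2"
    unfolding D1_def D2_def using cont cont' b by (auto intro!: continuous_intros)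
  have z: "D1 x = 0" "D2 x = 0" if "x \<notin> K" for x
    using that K(3) D0 by (auto simp: D1_def D2_def)
  have "(\<integral>x. frechet_derivative (\<lambda>x. \<phi> x * \<psi> x) (at x) b \<partial>lborel) = 0"
  proof (rule integral_partial_derivative_eq_0[OF _ _ K(1)])
    show "(\<lambda>x. \<phi> x * \<psi> x) differentiable (at x)" for x
      using prod by (auto simp: differentiable_def)
    show "continuous_on UNIV (\<lambda>x. frechet_derivative (\<lambda>x. \<phi> x * \<psi> x) (at x) b)"
      unfolding D using c by (intro continuous_intros)
  qed (use K(3) in auto)
  then have "(\<integral>x. D1 x \<partial>lborel) + (\<integral>x. D2 x \<partial>lborel) = 0"
    unfolding D using integrable_continuous_compact_support[OF c(1) K(1) z(1)]
      integrable_continuous_compact_support[OF c(2) K(1) z(2)] by simp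
  moreover have "(\<integral>x. D1 x \<partial>lebesgue_on G) = (\<integral>x. D1 x \<partial>lborel)"
      "(\<integral>x. D2 x \<partial>lebesgue_on G) = (\<integral>x. D2 x \<partial>lborel)"
    using c z K(2) G by (auto intro!: integral_lebesgue_on_eq_lborel borel_measurable_continuous_onI)
  ultimately show "(\<integral>x. \<phi> x * frechet_derivative \<psi> (at x) b \<partial>lebesgue_on G)
      = - (\<integral>x. frechet_derivative \<phi> (at x) b * \<psi> x \<partial>lebesgue_on G)"
    by (simp add: D1_def D2_def)
qed

text \<open>Boxes form an intersection-stable generator of the Borel sets, so the vanishing of the integrals
  extends to all Borel sets by Dynkin's theorem.\<close>

lemma AE_eq_0_if_box_integrals_eq_0:
  fixes h :: "'a::euclidean_space \<Rightarrow> real"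
  assumes h: "integrable lborel h" "(\<integral>x. h x \<partial>lborel) = 0"
    and boxes: "\<And>a b. (\<integral>x. indicator (box a b) x * h x \<partial>lborel) = 0"
  shows "AE x in lborel. h x = 0"
proof -
  let ?E = "range (\<lambda>(a, b). box a b) :: 'a set set"
  have int: "integrable lborel (\<lambda>x. indicator A x * h x)" if "A \<in> sets borel" for A
    using integrable_mult_indicator[of A lborel h] that h by simp
  have sets: "sigma_sets UNIV ?E = sets borel"
    by (simp add: borel_eq_box)
  have "(\<integral>x. indicator A x * h x \<partial>lborel) = 0" if "A \<in> sets borel" for A
  proof -
    have "Int_stable ?E"
      by (auto simp: Int_stable_def box_Int_box)
    moreover have "?E \<subseteq> Pow UNIV"
      by simp
    moreover have "A \<in> sigma_sets UNIV ?E"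
      using that sets by simp
    ultimately show ?thesis
    proof (induction rule: sigma_sets_induct_disjoint)
      case (basic A)
      then show ?case using boxes by auto
    next
      case empty
      show ?case by simp
    next
      case (compl A)
      then have "A \<in> sets borel"
        using sets by simp
      moreover have "(\<lambda>x. indicator (UNIV - A) x * h x) = (\<lambda>x. h x - indicator A x * h x)"
        by (auto simp: fun_eq_iff indicator_def)
      ultimately show ?case
        using compl int h by simp
    next
      case (union A)
      have A: "A i \<in> sets borel" for i
        using union sets by auto
      have "(\<integral>x. indicator (\<Union>i. A i) x *\<^sub>R h x \<partial>lborel)
          = (\<Sum>i. \<integral>x. indicator (A i) x *\<^sub>R h x \<partial>lborel)"
        using union(1) A int[of "\<Union>i. A i"]
        by (intro lebesgue_integral_countable_add[unfolded set_lebesgue_integral_def])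
          (auto simp: set_integrable_def disjoint_family_on_def)
      with union show ?case by simp
    qed
  qed
  then show ?thesis
    using h by (intro density_unique_real) (auto simp: set_lebesgue_integral_def)
qed

text \<open>The hypothesis is restricted to boxes whose closure lies in \<open>G\<close>, as only these have bumps that are
  test functions on \<open>G\<close>. The intersection of such a box with any box is again one, so the previous lemma
  applies to \<open>v\<close> restricted to such a box. Countably many closed boxes cover \<open>G\<close>, and their boundaries
  are null sets.\<close>

lemma AE_lebesgue_on_eq_0_if_boxes:
  fixes v :: "'a::euclidean_space \<Rightarrow> real"
  assumes "open G" and v: "integrable (lebesgue_on G) v"
    and boxes: "\<And>a b. cbox a b \<subseteq> G \<Longrightarrow> (\<integral>x. indicator (box a b) x * v x \<partial>lebesgue_on G) = 0"
  shows "AE x in lebesgue_on G. v x = 0"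
proof -
  define f where "f x = indicator G x *\<^sub>R v x" for x
  have f: "integrable lebesgue f"
    unfolding f_def using v assms(1) by (subst (asm) integrable_restrict_space) auto
  then obtain g where g[measurable]: "g \<in> borel_measurable lborel" and fg: "AE x in lborel. f x = g x"
    using completion_ex_borel_measurable_real[of f lborel] borel_measurable_integrable by blast
  have fg': "AE x in lebesgue. f x = g x"
    using fg by (rule AE_completion)
  have gint: "integrable lborel g"
    using integrable_cong_AE[THEN iffD1, OF _ _ fg' f] f
    by (simp add: integrable_completion borel_measurable_integrable measurable_completion)
  have gbox: "(\<integral>x. indicator (box a b) x * g x \<partial>lborel) = 0" if "cbox a b \<subseteq> G" for a b
  proof -
    have "(\<integral>x. indicator (box a b) x * g x \<partial>lborel) = (\<integral>x. indicator (box a b) x * g x \<partial>lebesgue)"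
      by (rule integral_completion[symmetric]) measurable
    also have "\<dots> = (\<integral>x. indicator (box a b) x * f x \<partial>lebesgue)"
    proof (rule integral_cong_AE)
      show "(\<lambda>x. indicator (box a b) x * g x) \<in> borel_measurable lebesgue"
        by (rule measurable_completion) measurable
      show "(\<lambda>x. indicator (box a b) x * f x) \<in> borel_measurable lebesgue"
        using f by (intro borel_measurable_times borel_measurable_indicator) auto
      show "AE x in lebesgue. indicator (box a b) x * g x = indicator (box a b) x * f x"
        using fg' by eventually_elim simp
    qed
    also have "\<dots> = (\<integral>x. indicator G x *\<^sub>R (indicator (box a b) x * v x) \<partial>lebesgue)"
      by (simp add: f_def mult.left_commute)
    also have "\<dots> = (\<integral>x. indicator (box a b) x * v x \<partial>lebesgue_on G)"
      using assms(1) by (intro integral_restrict_space[symmetric]) auto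
    finally show ?thesis
      using boxes[OF that] by simp
  qed
  have loc: "AE x in lebesgue. x \<in> cbox c d \<longrightarrow> g x = 0" if cd: "cbox c d \<subseteq> G" for c d
  proof -
    have "AE x in lborel. indicator (box c d) x * g x = 0"
    proof (rule AE_eq_0_if_box_integrals_eq_0)
      show "integrable lborel (\<lambda>x. indicator (box c d) x * g x)"
        using integrable_mult_indicator[of "box c d" lborel g] gint by simp
      show "(\<integral>x. indicator (box c d) x * g x \<partial>lborel) = 0"
        using gbox cd .
      show "(\<integral>x. indicator (box a b) x * (indicator (box c d) x * g x) \<partial>lborel) = 0" for a b
      proof -
        define l u where "l = (\<Sum>i\<in>Basis. max (a\<bullet>i) (c\<bullet>i) *\<^sub>R i)"
          and "u = (\<Sum>i\<in>Basis. min (b\<bullet>i) (d\<bullet>i) *\<^sub>R i)"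
        have "box a b \<inter> box c d = box l u" "cbox a b \<inter> cbox c d = cbox l u"
          unfolding l_def u_def by (rule box_Int_box, rule Int_interval)
        moreover have "(\<lambda>x. indicator (box a b) x * (indicator (box c d) x * g x))
            = (\<lambda>x. indicator (box a b \<inter> box c d) x * g x)"
          by (auto simp: fun_eq_iff indicator_def)
        ultimately show ?thesis
          using gbox[of l u] cd by auto
      qed
    qed
    then have "AE x in lebesgue. indicator (box c d) x * g x = 0"
      by (rule AE_completion)
    moreover have "AE x in lebesgue. x \<notin> cbox c d - box c d"
      using negligible_frontier_interval[of c d]
      by (intro AE_not_in) (simp add: negligible_iff_null_sets)
    ultimately show ?thesis
      by eventually_elim (auto simp: indicator_def split: if_splits)
  qed
  obtain D where D: "countable D" "D \<subseteq> Pow G" "\<And>I. I \<in> D \<Longrightarrow> \<exists>a b. I = cbox a b" "\<Union> D = G"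
    using open_countable_Union_open_cbox[OF assms(1)] by metis
  have "AE x in lebesgue. \<forall>I\<in>D. x \<in> I \<longrightarrow> g x = 0"
    using D(2,3) loc by (subst AE_ball_countable[OF D(1)]) blast
  then have "AE x in lebesgue. x \<in> G \<longrightarrow> g x = 0"
    by eventually_elim (use D(4) in blast)
  then have "AE x in lebesgue. x \<in> G \<longrightarrow> v x = 0"
    using fg' by eventually_elim (metis f_def indicator_simps(1) scaleR_one)
  then show ?thesis
    using assms(1) by (subst AE_restrict_space_iff) auto
qed


lemma integrable_lebesgue_on_square:
  fixes v :: "'a::euclidean_space \<Rightarrow> real"
  assumes "open G" "bounded G" "v \<in> elts (L2_dom G)"
  shows "integrable (lebesgue_on G) v"
proof -
  have "G \<in> lmeasurable"
    using assms(1,2) by (intro bounded_set_imp_lmeasurable) auto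
  then have "finite_measure (lebesgue_on G)"
    by (rule finite_measure_lebesgue_on)
  moreover have "v \<in> borel_measurable (lebesgue_on G)" "integrable (lebesgue_on G) (\<lambda>x. (v x)\<^sup>2)"
    using assms(3) by (simp_all add: L2_def)
  ultimately show ?thesis
    by (rule finite_measure.square_integrable_imp_integrable)
qed

text \<open>The fundamental lemma of the calculus of variations: passing to the limit in the box bumps reduces
  it to integrals over boxes.\<close>

lemma AE_eq_0_if_test_integrals_eq_0:
  fixes v :: "'a::euclidean_space \<Rightarrow> real"
  assumes G: "open G" "bounded G" and v: "v \<in> elts (L2_dom G)"
    and test: "\<And>\<phi>. \<phi> \<in> test_functions G \<Longrightarrow> (\<integral>x. v x * \<phi> x \<partial>lebesgue_on G) = 0"
  shows "AE x in lebesgue_on G. v x = 0"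
proof (rule AE_lebesgue_on_eq_0_if_boxes[OF G(1)])
  show vint: "integrable (lebesgue_on G) v"
    using integrable_lebesgue_on_square[OF G v] .
  fix a b :: 'a assume ab: "cbox a b \<subseteq> G"
  have [measurable]: "v \<in> borel_measurable (lebesgue_on G)"
    using v by (simp add: L2_def)
  have bump: "(\<lambda>x. 1 * box_bump (real (Suc k)) a b x) \<in> test_functions G" for k
    using ab by (intro box_bump_test_function) auto
  then have "box_bump (real (Suc k)) a b \<in> borel_measurable lborel" for k
    using test_functionD(2)[OF bump[of k]] by (simp add: borel_measurable_continuous_onI)
  then have [measurable]: "box_bump (real (Suc k)) a b \<in> borel_measurable (lebesgue_on G)" for k
    by (intro measurable_restrict_space1 measurable_completion)
  have [measurable]: "(\<lambda>x. indicator (box a b) x :: real) \<in> borel_measurable (lebesgue_on G)"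
    by (intro measurable_restrict_space1 borel_measurable_indicator) auto
  have "(\<lambda>k. \<integral>x. v x * box_bump (real (Suc k)) a b x \<partial>lebesgue_on G)
      \<longlonglongrightarrow> (\<integral>x. v x * indicator (box a b) x \<partial>lebesgue_on G)"
  proof (rule integral_dominated_convergence[where w = "\<lambda>x. \<bar>v x\<bar>"])
    show "AE x in lebesgue_on G. (\<lambda>k. v x * box_bump (real (Suc k)) a b x)
        \<longlonglongrightarrow> v x * indicator (box a b) x"
      by (intro AE_I2 tendsto_mult tendsto_const box_bump_tendsto_indicator)
    show "AE x in lebesgue_on G. norm (v x * box_bump (real (Suc k)) a b x) \<le> \<bar>v x\<bar>" for k
      using box_bump_bounded[of "real (Suc k)" a b]
      by (intro AE_I2) (auto simp: abs_mult intro!: mult_left_le)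
    show "(\<lambda>x. v x * box_bump (real (Suc k)) a b x) \<in> borel_measurable (lebesgue_on G)" for k
      by measurable
    show "(\<lambda>x. v x * indicator (box a b) x) \<in> borel_measurable (lebesgue_on G)"
      by measurable
  qed (use vint in auto)
  moreover have "(\<integral>x. v x * box_bump (real (Suc k)) a b x \<partial>lebesgue_on G) = 0" for k
    using test[OF bump[of k]] by simp
  ultimately have "(\<lambda>_::nat. 0) \<longlonglongrightarrow> (\<integral>x. v x * indicator (box a b) x \<partial>lebesgue_on G)"
    by (simp only:)
  then have "(\<integral>x. v x * indicator (box a b) x \<partial>lebesgue_on G) = 0"
    by (rule LIMSEQ_unique[OF _ tendsto_const])
  then show "(\<integral>x. indicator (box a b) x * v x \<partial>lebesgue_on G) = 0"
    by (simp only: mult.commute)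
qed

lemma nrm_L2_cong:
  assumes "AE x in M. u x = v x" "u \<in> elts (L2 M)" "v \<in> elts (L2 M)"
  shows "nrm (L2 M) u = nrm (L2 M) v"
proof -
  have "(\<integral>x. (u x)\<^sup>2 \<partial>M) = (\<integral>x. (v x)\<^sup>2 \<partial>M)"
  proof (rule integral_cong_AE)
    show "AE x in M. (u x)\<^sup>2 = (v x)\<^sup>2"
      using assms(1) by eventually_elim simp
  qed (use assms(2,3) in \<open>auto simp: L2_def\<close>)
  then show ?thesis by (simp add: L2_def)
qed

lemma integrable_mult_L2:
  assumes "u \<in> elts (L2 M)" "v \<in> elts (L2 M)"
  shows "integrable M (\<lambda>x. u x * v x)"
proof (rule Bochner_Integration.integrable_bound[of _ "\<lambda>x. (u x)\<^sup>2 + (v x)\<^sup>2"])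
  show "AE x in M. norm (u x * v x) \<le> norm ((u x)\<^sup>2 + (v x)\<^sup>2)"
  proof (rule AE_I2)
    fix x
    have "2 * (\<bar>u x\<bar> * \<bar>v x\<bar>) \<le> (u x)\<^sup>2 + (v x)\<^sup>2"
      using sum_squares_bound[of "\<bar>u x\<bar>" "\<bar>v x\<bar>"] by simp
    moreover have "0 \<le> \<bar>u x\<bar> * \<bar>v x\<bar>" by simp
    ultimately show "norm (u x * v x) \<le> norm ((u x)\<^sup>2 + (v x)\<^sup>2)"
      unfolding real_norm_def abs_mult by linarith
  qed
qed (use assms in \<open>auto simp: L2_def\<close>)

lemma L2_diff:
  assumes "u \<in> elts (L2 M)" "v \<in> elts (L2 M)"
  shows "u - v \<in> elts (L2 M)"
proof -
  have "integrable M (\<lambda>x. (u x)\<^sup>2 + (v x)\<^sup>2 - 2 * (u x * v x))"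
    using integrable_mult_L2[OF assms] assms by (auto simp: L2_def)
  moreover have "(\<lambda>x. (u x)\<^sup>2 + (v x)\<^sup>2 - 2 * (u x * v x)) = (\<lambda>x. ((u - v) x)\<^sup>2)"
    by (simp add: fun_eq_iff power2_diff)
  ultimately have "integrable M (\<lambda>x. ((u - v) x)\<^sup>2)"
    by (simp only:)
  moreover have "u - v \<in> borel_measurable M"
    unfolding fun_diff_def using assms by (intro borel_measurable_diff) (auto simp: L2_def)
  ultimately show ?thesis
    by (simp add: L2_def)
qed

text \<open>The Sobolev norm refers to a weak derivative selected by a choice operator. This lemma makes it
  computable from any weak derivative at hand.\<close>

lemma nrm_weak_deriv_eq:
  assumes G: "open G" "bounded G" and v: "is_weak_deriv G b u v"
  shows "nrm (L2_dom G) (weak_deriv G b u) = nrm (L2_dom G) v"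
proof -
  define w where "w = weak_deriv G b u"
  have w: "is_weak_deriv G b u w"
    unfolding w_def weak_deriv_def using v by (rule someI[where P = "is_weak_deriv G b u"])
  have L2: "w \<in> elts (L2_dom G)" "v \<in> elts (L2_dom G)"
    using v w by (auto simp: is_weak_deriv_def)
  have "AE x in lebesgue_on G. (w - v) x = 0"
  proof (rule AE_eq_0_if_test_integrals_eq_0[OF G L2_diff[OF L2]])
    fix \<phi> :: "'a \<Rightarrow> real" assume \<phi>: "\<phi> \<in> test_functions G"
    obtain K where K: "compact K" "\<And>x. x \<notin> K \<Longrightarrow> \<phi> x = 0"
      using test_functionD(4)[OF \<phi>] by blast
    have "\<phi> \<in> elts (L2_dom G)"
      using continuous_compact_support_in_L2_dom[OF G(1) test_functionD(2)[OF \<phi>] K] .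
    then have "integrable (lebesgue_on G) (\<lambda>x. w x * \<phi> x)" "integrable (lebesgue_on G) (\<lambda>x. v x * \<phi> x)"
      using integrable_mult_L2 L2 by blast+
    moreover have "(\<integral>x. w x * \<phi> x \<partial>lebesgue_on G) = (\<integral>x. v x * \<phi> x \<partial>lebesgue_on G)"
      using v w \<phi> by (fastforce simp: is_weak_deriv_def)
    ultimately show "(\<integral>x. (w - v) x * \<phi> x \<partial>lebesgue_on G) = 0"
      by (simp add: left_diff_distrib)
  qed
  then have "AE x in lebesgue_on G. w x = v x"
    by eventually_elim simp
  then show ?thesis
    unfolding w_def[symmetric] using L2 by (rule nrm_L2_cong)
qed

text \<open>The constant sequence approximates the function; its distance to the limit involves the selected
  weak derivatives of 0, which vanish almost everywhere by uniqueness.\<close>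

lemma test_function_in_H10:
  fixes \<phi> :: "'a::euclidean_space \<Rightarrow> real"
  assumes G: "open G" "bounded G" and \<phi>: "\<phi> \<in> test_functions G"
  shows "\<phi> \<in> elts (H10 G)"
proof -
  obtain K where K: "compact K" "\<And>x. x \<notin> K \<Longrightarrow> \<phi> x = 0"
    using test_functionD(4)[OF \<phi>] by blast
  have "\<phi> \<in> elts (L2_dom G)"
    using continuous_compact_support_in_L2_dom[OF G(1) test_functionD(2)[OF \<phi>] K] .
  then have H1: "\<phi> \<in> elts (H1 G)"
    using is_weak_deriv_test_function[OF G(1) \<phi>] by (auto simp: H1_def)
  have "is_weak_deriv G b 0 0" for b :: 'a
    by (simp add: is_weak_deriv_def L2_def zero_fun_def)
  then have "nrm (L2_dom G) (weak_deriv G b 0) = 0" for b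
    using nrm_weak_deriv_eq[OF G, of b 0 0] by (simp add: L2_def)
  moreover have "nrm (L2_dom G) 0 = 0"
    by (simp add: L2_def)
  ultimately have "nrm (H1 G) (\<phi> - \<phi>) = 0"
    by (simp add: H1_def)
  then show ?thesis
    using H1 \<phi> by (auto simp: H10_def intro!: exI[of _ "\<lambda>_. \<phi>"])
qed

text \<open>A box bump, scaled into the unit ball of \<open>H\<^sup>1\<^sub>0\<close> so that evaluating a functional at \<open>v\<close> is bounded by its
  dual norm.\<close>

lemma exists_unit_H10:
  fixes G :: "'a::euclidean_space set"
  assumes G: "open G" "bounded G" "G \<noteq> {}"
  obtains v where "v \<in> elts (H10 G)" "nrm (H10 G) v \<le> 1" "v \<in> elts (L2_dom G)"
    "(\<integral>x. v x * v x \<partial>lebesgue_on G) > 0"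
proof -
  obtain p where p: "p \<in> G"
    using G(3) by blast
  obtain a b where ab: "p \<in> box a b" "cbox a b \<subseteq> G"
    using open_contains_cbox[OF G(1) p] by metis
  define \<phi> where "\<phi> c = (\<lambda>x. c * box_bump 1 a b x)" for c
  have \<phi>: "\<phi> c \<in> test_functions G" for c
    unfolding \<phi>_def using ab by (intro box_bump_test_function) auto
  define d where "d i = (\<lambda>x. frechet_derivative (\<phi> 1) (at x) i)" for i
  have der: "is_weak_deriv G i (\<phi> c) (\<lambda>x. c * d i x)" if "i \<in> Basis" for i c
  proof -
    have "frechet_derivative (\<phi> c) (at x) i = c * d i x" for x
    proof -
      have "(\<phi> 1 has_derivative frechet_derivative (\<phi> 1) (at x)) (at x)"
        using test_functionD(1)[OF \<phi>] frechet_derivative_works by blast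
      then have "((\<lambda>x. c * \<phi> 1 x) has_derivative (\<lambda>h. c * frechet_derivative (\<phi> 1) (at x) h)) (at x)"
        by (rule has_derivative_mult_right)
      moreover have "(\<lambda>x. c * \<phi> 1 x) = \<phi> c"
        by (simp add: \<phi>_def)
      ultimately show ?thesis
        using frechet_derivative_at by (metis d_def)
    qed
    then show ?thesis
      using is_weak_deriv_test_function[OF G(1) \<phi> that, of c] by simp
  qed
  have scale: "nrm (L2_dom G) (\<lambda>x. c * f x) = \<bar>c\<bar> * nrm (L2_dom G) f" for c f
    by (simp add: L2_def power_mult_distrib real_sqrt_mult)
  define N where "N = nrm (H10 G) (\<phi> 1)"
  have N0: "N \<ge> 0"
    by (simp add: N_def H10_def H1_def sum_nonneg)
  have nrm: "nrm (H10 G) (\<phi> c) = \<bar>c\<bar> * N" for c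
  proof -
    have "nrm (L2_dom G) (\<phi> c) = \<bar>c\<bar> * nrm (L2_dom G) (\<phi> 1)"
      using scale[of c "\<phi> 1"] by (simp add: \<phi>_def)
    moreover have "nrm (L2_dom G) (weak_deriv G i (\<phi> c)) = \<bar>c\<bar> * nrm (L2_dom G) (weak_deriv G i (\<phi> 1))"
        if "i \<in> Basis" for i
      unfolding nrm_weak_deriv_eq[OF G(1,2) der[OF that]] scale by simp
    ultimately have "nrm (H10 G) (\<phi> c) = sqrt (\<bar>c\<bar>\<^sup>2 * ((nrm (L2_dom G) (\<phi> 1))\<^sup>2
        + (\<Sum>i\<in>Basis. (nrm (L2_dom G) (weak_deriv G i (\<phi> 1)))\<^sup>2)))"
      by (simp add: H10_def H1_def power_mult_distrib sum_distrib_left distrib_left)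
    then show ?thesis
      unfolding N_def by (simp add: H10_def H1_def real_sqrt_mult)
  qed
  \<comment> \<open>\<open>N + 1\<close> rather than \<open>N\<close> avoids having to show that the norm is nonzero.\<close>
  define c where "c = 1 / (N + 1)"
  have c: "c > 0"
    using N0 by (simp add: c_def)
  have mem: "\<phi> c \<in> elts (H10 G)"
    using test_function_in_H10[OF G(1,2) \<phi>] .
  then have L2: "\<phi> c \<in> elts (L2_dom G)"
    by (simp add: H10_def H1_def)
  have le: "nrm (H10 G) (\<phi> c) \<le> 1"
    unfolding nrm c_def using N0 by simp
  have "(\<integral>x. \<phi> c x * \<phi> c x \<partial>lebesgue_on G) \<noteq> 0"
  proof
    assume "(\<integral>x. \<phi> c x * \<phi> c x \<partial>lebesgue_on G) = 0"
    then have "AE x in lebesgue_on G. \<phi> c x * \<phi> c x = 0"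
      using integrable_mult_L2[OF L2 L2] by (subst (asm) integral_nonneg_eq_0_iff_AE) auto
    then have "AE x in lebesgue. x \<in> G \<longrightarrow> \<phi> c x = 0"
      using G(1) by (subst (asm) AE_restrict_space_iff) auto
    moreover have "x \<in> G \<and> \<phi> c x \<noteq> 0" if "x \<in> box a b" for x
      using that c ab(2) box_subset_cbox[of a b] by (auto simp: \<phi>_def box_bump_eq)
    ultimately have "AE x in lebesgue. x \<notin> box a b"
      by (auto elim!: eventually_mono)
    then have "box a b \<in> null_sets lebesgue"
      by (subst AE_iff_null_sets) auto
    then have "negligible (box a b)"
      by (simp add: negligible_iff_null_sets)
    then show False
      using ab(1) open_not_negligible[of "box a b"] by auto
  qed
  moreover have "(\<integral>x. \<phi> c x * \<phi> c x \<partial>lebesgue_on G) \<ge> 0"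
    by (intro integral_nonneg_AE) simp
  ultimately show ?thesis
    using that mem le L2 by (metis order_le_less)
qed

section \<open>Scalar processes obtained by pairing with a fixed element\<close>

text \<open>The dual norm is a supremum of reals, so the bound needs the values on the unit ball to be bounded
  above. This follows from continuity of \<open>F\<close> because the norm on \<open>X\<close> is nonnegative.\<close>

lemma dual_nspace_bound:
  assumes "F \<in> elts (dual_nspace X)" "v \<in> elts X" "nrm X v \<le> 1" "\<And>u. 0 \<le> nrm X u"
  shows "\<bar>F v\<bar> \<le> nrm (dual_nspace X) F"
proof -
  obtain C where C: "\<And>u. u \<in> elts X \<Longrightarrow> \<bar>F u\<bar> \<le> C * nrm X u"
    using assms(1) unfolding dual_nspace_def by auto blast
  have "bdd_above ((\<lambda>u. \<bar>F u\<bar>) ` {u \<in> elts X. nrm X u \<le> 1})"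
  proof (rule bdd_aboveI2)
    fix u assume u: "u \<in> {u \<in> elts X. nrm X u \<le> 1}"
    have "\<bar>F u\<bar> \<le> C * nrm X u"
      using C u by simp
    also have "\<dots> \<le> \<bar>C\<bar> * 1"
      using u assms(4)[of u] by (intro mult_mono) auto
    finally show "\<bar>F u\<bar> \<le> \<bar>C\<bar>" by simp
  qed
  then have "\<bar>F v\<bar> \<le> (SUP u\<in>{u \<in> elts X. nrm X u \<le> 1}. \<bar>F u\<bar>)"
    using assms(2,3) by (intro cSUP_upper) auto
  then show ?thesis
    by (simp add: dual_nspace_def)
qed

lemma dual_nspace_lincomb:
  assumes "F \<in> elts (dual_nspace X)" "H \<in> elts (dual_nspace X)"
  shows "c *\<^sub>R F + d *\<^sub>R H \<in> elts (dual_nspace X)"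
proof -
  obtain C D where C: "\<And>u. u \<in> elts X \<Longrightarrow> \<bar>F u\<bar> \<le> C * nrm X u"
    and D: "\<And>u. u \<in> elts X \<Longrightarrow> \<bar>H u\<bar> \<le> D * nrm X u"
    using assms unfolding dual_nspace_def by auto blast
  have "\<bar>c * F u + d * H u\<bar> \<le> (\<bar>c\<bar> * C + \<bar>d\<bar> * D) * nrm X u" if "u \<in> elts X" for u
  proof -
    have "\<bar>c * F u + d * H u\<bar> \<le> \<bar>c\<bar> * \<bar>F u\<bar> + \<bar>d\<bar> * \<bar>H u\<bar>"
      by (metis abs_mult abs_triangle_ineq)
    also have "\<dots> \<le> \<bar>c\<bar> * (C * nrm X u) + \<bar>d\<bar> * (D * nrm X u)"
      using C[OF that] D[OF that] by (intro add_mono mult_left_mono) auto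
    finally show ?thesis by (simp add: algebra_simps)
  qed
  then have "\<exists>C. \<forall>u\<in>elts X. \<bar>c * F u + d * H u\<bar> \<le> C * nrm X u"
    by blast
  moreover have "c * F (r *\<^sub>R u + u') + d * H (r *\<^sub>R u + u')
      = r * (c * F u + d * H u) + (c * F u' + d * H u')"
    if "u \<in> elts X" "u' \<in> elts X" for r u u'
  proof -
    have "F (r *\<^sub>R u + u') = r * F u + F u'" "H (r *\<^sub>R u + u') = r * H u + H u'"
      using assms that by (auto simp: dual_nspace_def)
    then show ?thesis
      by (simp add: algebra_simps)
  qed
  ultimately show ?thesis
    by (simp add: dual_nspace_def scaleR_fun_def)
qed

lemma dual_nspace_diff:
  assumes "F \<in> elts (dual_nspace X)" "H \<in> elts (dual_nspace X)"
  shows "F - H \<in> elts (dual_nspace X)"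
  using dual_nspace_lincomb[OF assms, of 1 "-1"] by simp

lemma zero_in_dual_nspace: "0 \<in> elts (dual_nspace X)"
  by (auto simp: dual_nspace_def intro!: exI[of _ 0])

text \<open>Pairing with \<open>v\<close> is bounded by the dual norm, hence turns the approximating simple functions
  into real simple functions that converge pointwise.\<close>

lemma borel_measurable_pairing:
  assumes f: "strongly_measurable M (dual_nspace X) f"
    and v: "v \<in> elts X" "nrm X v \<le> 1" "\<And>u. 0 \<le> nrm X u"
  shows "(\<lambda>w. f w v) \<in> borel_measurable M"
proof -
  obtain s :: "nat \<Rightarrow> _" where s: "\<And>k. simple_function M (s k)"
      "\<And>k w. w \<in> space M \<Longrightarrow> s k w \<in> elts (dual_nspace X)"
      "\<And>w. w \<in> space M \<Longrightarrow> (\<lambda>k. nrm (dual_nspace X) (s k w - f w)) \<longlonglongrightarrow> 0"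
    and elt: "\<And>w. w \<in> space M \<Longrightarrow> f w \<in> elts (dual_nspace X)"
    using f unfolding strongly_measurable_def by blast
  show ?thesis
  proof (rule borel_measurable_LIMSEQ_real)
    show "(\<lambda>w. s k w v) \<in> borel_measurable M" for k
      by (rule borel_measurable_simple_function, rule simple_function_compose1[OF s(1)])
    fix w assume w: "w \<in> space M"
    have "(\<lambda>k. s k w v - f w v) \<longlonglongrightarrow> 0"
    proof (rule Lim_null_comparison[OF always_eventually s(3)[OF w]], intro allI)
      show "norm (s k w v - f w v) \<le> nrm (dual_nspace X) (s k w - f w)" for k
        using dual_nspace_bound[OF dual_nspace_diff[OF s(2)[OF w] elt[OF w]] v] by simp
    qed
    then show "(\<lambda>k. s k w v) \<longlonglongrightarrow> f w v"
      by (rule LIM_zero_cancel)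
  qed
qed

text \<open>Restricting the approximating simple functions on \<open>{a..t} \<times> \<Omega>\<close> to the section at time \<open>t\<close>.\<close>

lemma progressive_imp_adapted:
  assumes "progressive F X a b f" "t \<in> {a..b}"
  shows "strongly_measurable (F t) X (f t)"
proof -
  let ?N = "restrict_space borel {a..t} \<Otimes>\<^sub>M F t"
  have "strongly_measurable ?N X (\<lambda>(s, w). f s w)"
    using assms by (auto simp: progressive_def)
  then obtain s :: "nat \<Rightarrow> _" where s: "\<And>k. simple_function ?N (s k)"
      "\<And>k p. p \<in> space ?N \<Longrightarrow> s k p \<in> elts X"
      "\<And>p. p \<in> space ?N \<Longrightarrow> (\<lambda>k. nrm X (s k p - (case p of (s, w) \<Rightarrow> f s w))) \<longlonglongrightarrow> 0"
      and elt: "\<And>p. p \<in> space ?N \<Longrightarrow> (case p of (s, w) \<Rightarrow> f s w) \<in> elts X"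
    unfolding strongly_measurable_def by blast
  have t: "t \<in> space (restrict_space borel {a..t})"
    using assms(2) by (simp add: space_restrict_space)
  then have p: "(t, w) \<in> space ?N" if "w \<in> space (F t)" for w
    using that by (simp add: space_pair_measure)
  have "simple_function (F t) (\<lambda>w. s k (t, w))" for k
    using simple_function_comp[OF measurable_Pair1'[OF t] s(1)] .
  then show ?thesis
    unfolding strongly_measurable_def using s(2,3)[OF p] elt[OF p]
    by (intro conjI exI[of _ "\<lambda>k w. s k (t, w)"]) auto
qed

section \<open>The increments of a Brownian motion\<close>

lemma
  assumes "brownian_motion P T W" "0 \<le> s" "s \<le> T"
  shows space_natural_filtration: "space (natural_filtration P W s) = space P"
    and sets_natural_filtration_subset: "sets (natural_filtration P W s) \<subseteq> sets P"
proof -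
  let ?E = "{W r -` B \<inter> space P | r B. 0 \<le> r \<and> r \<le> s \<and> B \<in> sets borel} \<union> null_sets P"
  have W: "W t \<in> borel_measurable P" if "0 \<le> t" "t \<le> s" for t
    using assms that by (auto simp: brownian_motion_def)
  have sub: "?E \<subseteq> sets P"
    using W by (auto intro: measurable_sets)
  then have "?E \<subseteq> Pow (space P)"
    using sets.space_closed by blast
  then have "sets (natural_filtration P W s) = sigma_sets (space P) ?E"
      "space (natural_filtration P W s) = space P"
    unfolding natural_filtration_def by (rule sets_measure_of, rule space_measure_of)
  then show "space (natural_filtration P W s) = space P"
      "sets (natural_filtration P W s) \<subseteq> sets P"
    using sets.sigma_sets_subset[OF sub] by auto
qed

lemma brownian_motion_adapted:
  assumes "brownian_motion P T W" "0 \<le> s" "s \<le> T"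
  shows "W s \<in> borel_measurable (natural_filtration P W s)"
proof -
  let ?E = "{W r -` B \<inter> space P | r B. 0 \<le> r \<and> r \<le> s \<and> B \<in> sets borel} \<union> null_sets P"
  have "?E \<subseteq> Pow (space P)"
    using sets.sets_into_space by (auto dest: null_setsD2)
  then have "sets (natural_filtration P W s) = sigma_sets (space P) ?E"
    unfolding natural_filtration_def by (rule sets_measure_of)
  moreover have "W s -` B \<inter> space P \<in> ?E" if "B \<in> sets borel" for B
    using that assms by auto
  ultimately show ?thesis
    by (intro measurableI) (auto simp: space_natural_filtration[OF assms])
qed

lemma brownian_increment_moments:
  assumes "prob_space P" "brownian_motion P T W" "0 \<le> s" "s < T"
  shows "integrable P (\<lambda>w. W T w - W s w)" "integrable P (\<lambda>w. (W T w - W s w)\<^sup>2)"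
    "(\<integral>w. W T w - W s w \<partial>P) = 0" "(\<integral>w. (W T w - W s w)\<^sup>2 \<partial>P) = T - s"
proof -
  interpret prob_space P by fact
  have D: "distributed P lborel (\<lambda>w. W T w - W s w)
      (\<lambda>x. ennreal (normal_density 0 (sqrt (T - s)) x))"
    using assms by (auto simp: brownian_motion_def)
  have pos: "0 < sqrt (T - s)"
    using assms by simp
  show "integrable P (\<lambda>w. W T w - W s w)"
    using integrable_normal_moment_nz_1[OF pos, of 0]
    by (subst distributed_integrable[OF D, of "\<lambda>x. x", symmetric]) auto
  show "integrable P (\<lambda>w. (W T w - W s w)\<^sup>2)"
    using integrable_normal_moment[OF pos, of 0 2]
    by (subst distributed_integrable[OF D, of "\<lambda>x. x\<^sup>2", symmetric]) auto
  show mean: "(\<integral>w. W T w - W s w \<partial>P) = 0"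
    by (rule normal_distributed_expectation[OF pos D])
  show "(\<integral>w. (W T w - W s w)\<^sup>2 \<partial>P) = T - s"
    using normal_distributed_variance[OF pos D] assms(4) by (simp add: mean)
qed

lemma square_integrable_diff:
  fixes f g :: "'w \<Rightarrow> real"
  assumes "f \<in> borel_measurable M" "g \<in> borel_measurable M"
    "integrable M (\<lambda>w. (f w)\<^sup>2)" "integrable M (\<lambda>w. (g w)\<^sup>2)"
  shows "integrable M (\<lambda>w. (f w - g w)\<^sup>2)"
  using L2_diff[of f M g] assms by (simp add: L2_def)

text \<open>Write \<open>Y - c W(T) = X - c N\<close> with the increment \<open>N = W(T) - W(s)\<close> and \<open>X = Y - c W(s)\<close>. Then \<open>X\<close> is
  independent of the centred variable \<open>N\<close>, the mixed term vanishes, and the variance \<open>c\<^sup>2 (T - s)\<close> of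
  \<open>c N\<close> remains as a lower bound.\<close>

lemma brownian_approximation_error:
  assumes P: "prob_space P" and W: "brownian_motion P T W" and s: "0 \<le> s" "s < T"
    and Y: "Y \<in> borel_measurable (natural_filtration P W s)"
  shows "ennreal (c\<^sup>2 * (T - s)) \<le> (\<integral>\<^sup>+w. ennreal ((Y w - c * W T w)\<^sup>2) \<partial>P)"
proof (cases "(\<integral>\<^sup>+w. ennreal ((Y w - c * W T w)\<^sup>2) \<partial>P) < \<infinity>")
  case False
  then show ?thesis by (simp add: not_less top_unique)
next
  case True
  interpret prob_space P by fact
  note F = space_natural_filtration[OF W s(1)] sets_natural_filtration_subset[OF W s(1)]
  define N where "N w = W T w - W s w" for w
  define X where "X w = Y w - c * W s w" for w
  note N = brownian_increment_moments[OF P W s, folded N_def]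
  have XF: "X \<in> borel_measurable (natural_filtration P W s)"
    unfolding X_def using Y brownian_motion_adapted[OF W s(1)] s by (intro borel_measurable_diff borel_measurable_times) auto
  have [measurable]: "X \<in> borel_measurable P"
    by (rule measurable_from_subalg[OF _ XF]) (use F s in \<open>auto simp: subalgebra_def\<close>)
  have [measurable]: "N \<in> borel_measurable P"
    using N(1) by (rule borel_measurable_integrable)
  have eq: "Y w - c * W T w = X w - c * N w" for w
    by (simp add: X_def N_def algebra_simps)
  have err: "integrable P (\<lambda>w. (X w - c * N w)\<^sup>2)"
    using True unfolding eq by (intro integrableI_bounded) auto
  \<comment> \<open>Square integrability of the error, assumed in this case, carries over to \<open>X\<close>.\<close>
  have "integrable P (\<lambda>w. (c * N w)\<^sup>2)"
    using N(2) by (simp add: power_mult_distrib)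
  then have cN: "integrable P (\<lambda>w. (- (c * N w))\<^sup>2)"
    by (simp only: power2_minus)
  have "integrable P (\<lambda>w. ((X w - c * N w) - (- (c * N w)))\<^sup>2)"
    by (rule square_integrable_diff[OF _ _ err cN]; measurable)
  then have X2: "integrable P (\<lambda>w. (X w)\<^sup>2)"
    by (simp only: diff_minus_eq_add diff_add_cancel)
  then have X1: "integrable P X"
    by (rule square_integrable_imp_integrable[rotated]) simp
  have mono: "indep_set A0 B" if "indep_set A B" "A0 \<subseteq> A" for A A0 B
    using that unfolding indep_sets2_eq by blast
  have "indep_set (sets (natural_filtration P W s)) {N -` B \<inter> space P | B. B \<in> sets borel}"
    using W s unfolding brownian_motion_def N_def by blast
  then have "indep_set {X -` B \<inter> space P | B. B \<in> sets borel} {N -` B \<inter> space P | B. B \<in> sets borel}"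
    by (rule mono) (use measurable_sets[OF XF] F(1) s in auto)
  moreover have "Int_stable {Z -` B \<inter> space P | B. B \<in> sets borel}" for Z :: "_ \<Rightarrow> real"
  proof (rule Int_stableI)
    fix A B assume "A \<in> {Z -` B \<inter> space P | B. B \<in> sets borel}" "B \<in> {Z -` B \<inter> space P | B. B \<in> sets borel}"
    then obtain A' B' where "A = Z -` A' \<inter> space P" "B = Z -` B' \<inter> space P" "A' \<in> sets borel" "B' \<in> sets borel"
      by blast
    then show "A \<inter> B \<in> {Z -` B \<inter> space P | B. B \<in> sets borel}"
      by (intro CollectI exI[of _ "A' \<inter> B'"]) (simp add: vimage_Int Int_ac)
  qed
  ultimately have "indep_set (sigma_sets (space P) {X -` B \<inter> space P | B. B \<in> sets borel})
      (sigma_sets (space P) {N -` B \<inter> space P | B. B \<in> sets borel})"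
    by (intro indep_set_sigma_sets)
  then have indep: "indep_var borel X borel N"
    by (subst indep_var_eq) simp
  have XN: "integrable P (\<lambda>w. X w * N w)" "(\<integral>w. X w * N w \<partial>P) = 0"
    using indep_var_integrable[OF indep X1 N(1)] indep_var_lebesgue_integral[OF indep X1 N(1)]
    by (simp_all only: N(3) mult_zero_right)
  have N2: "integrable P (\<lambda>w. c\<^sup>2 * (N w)\<^sup>2)" and XN': "integrable P (\<lambda>w. (2 * c) * (X w * N w))"
    using N(2) XN(1) by (auto intro: integrable_mult_right)
  have "c\<^sup>2 * (T - s) \<le> (\<integral>w. (X w)\<^sup>2 \<partial>P) + c\<^sup>2 * (\<integral>w. (N w)\<^sup>2 \<partial>P) - (2 * c) * (\<integral>w. X w * N w \<partial>P)"
    unfolding XN N(4) by simp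
  also have "\<dots> = (\<integral>w. (X w)\<^sup>2 + c\<^sup>2 * (N w)\<^sup>2 - (2 * c) * (X w * N w) \<partial>P)"
    by (simp only: Bochner_Integration.integral_diff[OF Bochner_Integration.integrable_add[OF X2 N2] XN']
        Bochner_Integration.integral_add[OF X2 N2] integral_mult_right_zero)
  also have "(\<lambda>w. (X w)\<^sup>2 + c\<^sup>2 * (N w)\<^sup>2 - (2 * c) * (X w * N w)) = (\<lambda>w. (Y w - c * W T w)\<^sup>2)"
    unfolding eq by (simp add: fun_eq_iff power2_eq_square algebra_simps)
  finally have "ennreal (c\<^sup>2 * (T - s)) \<le> ennreal (\<integral>w. (Y w - c * W T w)\<^sup>2 \<partial>P)"
    by (rule ennreal_leI)
  also have "\<dots> = (\<integral>\<^sup>+w. ennreal ((Y w - c * W T w)\<^sup>2) \<partial>P)"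
    using err unfolding eq by (intro nn_integral_eq_integral[symmetric]) auto
  finally show ?thesis .
qed


text \<open>The difference quotient at \<open>T\<close> stays bounded in \<open>L\<^sup>2(\<Omega>)\<close>: it is within distance 1 of the derivative
  \<open>f' T\<close> once \<open>s\<close> is close to \<open>T\<close>. This explains the constant \<open>2 + 2 E \<parallel>f' T\<parallel>\<^sup>2\<close>.\<close>

lemma C1_L2_proc_final_rate:
  assumes P: "prob_space P"
    and F: "\<And>s. 0 \<le> s \<Longrightarrow> s \<le> T \<Longrightarrow> subalgebra P (F s)"
    and f: "C1_L2_proc P F (dual_nspace X) 0 T f f'" and T: "T > 0"
    and v: "v \<in> elts X" "nrm X v \<le> 1" "\<And>u. 0 \<le> nrm X u"
  obtains K where "K > 0"
    "\<forall>\<^sub>F s in at_left T. (\<integral>\<^sup>+w. ennreal ((f s w v - f T w v)\<^sup>2) \<partial>P) \<le> ennreal (K * (T - s)\<^sup>2)"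
proof -
  let ?X = "dual_nspace X"
  define q where "q s w = (1 / (s - T)) *\<^sub>R (f s w - f T w)" for s w
  have adapted: "strongly_measurable (F s) ?X (f s)" "strongly_measurable (F s) ?X (f' s)"
    if "s \<in> {0..T}" for s
    using f that unfolding C1_L2_proc_def C_L2_proc_def by (auto intro: progressive_imp_adapted)
  have elt: "f s w \<in> elts ?X" "f' s w \<in> elts ?X" if "s \<in> {0..T}" "w \<in> space P" for s w
    using adapted[OF that(1)] F[of s] that by (auto simp: strongly_measurable_def subalgebra_def)
  have meas: "(\<lambda>w. f s w v) \<in> borel_measurable P" "(\<lambda>w. f' s w v) \<in> borel_measurable P"
    if "s \<in> {0..T}" for s
    using that F[of s] adapted[OF that] borel_measurable_pairing[OF _ v]
    by (auto intro!: measurable_from_subalg[of P "F s"])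
  define J where "J = enn2real (E_sq P ?X (f' T))"
  have "E_sq P ?X (f' T) < \<infinity>"
    using f T by (auto simp: C1_L2_proc_def C_L2_proc_def L2_rv_def)
  then have J: "E_sq P ?X (f' T) = ennreal J" "J \<ge> 0"
    by (auto simp: J_def)
  have "((\<lambda>s. E_sq P ?X (\<lambda>w. q s w - f' T w)) \<longlongrightarrow> 0) (at_left T)"
    using f T unfolding C1_L2_proc_def q_def at_within_Icc_at_left[OF T, symmetric] by auto
  then have "\<forall>\<^sub>F s in at_left T. E_sq P ?X (\<lambda>w. q s w - f' T w) < 1"
    by (rule order_tendstoD) simp
  moreover have "\<forall>\<^sub>F s in at_left T. s \<in> {0..<T}"
    by (rule eventually_at_leftI[of 0]) (use T in auto)
  ultimately have "\<forall>\<^sub>F s in at_left T.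
      (\<integral>\<^sup>+w. ennreal ((f s w v - f T w v)\<^sup>2) \<partial>P) \<le> ennreal ((2 + 2 * J) * (T - s)\<^sup>2)"
  proof eventually_elim
    case (elim s)
    then have s: "s \<in> {0..T}" "s < T" and TT: "T \<in> {0..T}"
      by auto
    define d where "d w = (f s w v - f T w v) / (s - T)" for w
    have [measurable]: "d \<in> borel_measurable P" "(\<lambda>w. f' T w v) \<in> borel_measurable P"
      unfolding d_def using meas[OF s(1)] meas[OF TT] by measurable
    have err: "(\<integral>\<^sup>+w. ennreal ((d w - f' T w v)\<^sup>2) \<partial>P) \<le> 1"
    proof -
      have "(\<integral>\<^sup>+w. ennreal ((d w - f' T w v)\<^sup>2) \<partial>P) \<le> E_sq P ?X (\<lambda>w. q s w - f' T w)"
        unfolding E_sq_def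
      proof (intro nn_integral_mono ennreal_leI)
        fix w assume w: "w \<in> space P"
        have "q s w \<in> elts ?X"
          unfolding q_def
          using dual_nspace_lincomb[OF dual_nspace_diff[OF elt(1)[OF s(1) w] elt(1)[OF TT w]] zero_in_dual_nspace]
          by (metis add.right_neutral scaleR_zero_right)
        then have "\<bar>(q s w - f' T w) v\<bar> \<le> nrm ?X (q s w - f' T w)"
          using dual_nspace_bound[OF dual_nspace_diff v] elt(2)[OF TT w] by blast
        moreover have "(q s w - f' T w) v = d w - f' T w v"
          by (simp add: q_def d_def scaleR_fun_def)
        ultimately show "(d w - f' T w v)\<^sup>2 \<le> (nrm ?X (q s w - f' T w))\<^sup>2"
          by (metis abs_ge_zero power2_abs power_mono)
      qed
      with elim(1) show ?thesis by simp
    qed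
    have der: "(\<integral>\<^sup>+w. ennreal ((f' T w v)\<^sup>2) \<partial>P) \<le> ennreal J"
      unfolding J(1)[symmetric] E_sq_def
    proof (intro nn_integral_mono ennreal_leI)
      fix w assume w: "w \<in> space P"
      have "\<bar>f' T w v\<bar> \<le> nrm ?X (f' T w)"
        using dual_nspace_bound[OF elt(2)[OF TT w] v] .
      then show "(f' T w v)\<^sup>2 \<le> (nrm ?X (f' T w))\<^sup>2"
        by (metis abs_ge_zero power2_abs power_mono)
    qed
    have "(\<integral>\<^sup>+w. ennreal ((f s w v - f T w v)\<^sup>2) \<partial>P)
        \<le> (\<integral>\<^sup>+w. ennreal ((T - s)\<^sup>2) * (2 * ennreal ((d w - f' T w v)\<^sup>2) + 2 * ennreal ((f' T w v)\<^sup>2)) \<partial>P)"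
    proof (intro nn_integral_mono)
      fix w
      have "(f s w v - f T w v)\<^sup>2 = (T - s)\<^sup>2 * (d w)\<^sup>2"
        using s(2) by (simp add: d_def power_divide power2_commute[of s T])
      also have "(d w)\<^sup>2 \<le> 2 * (d w - f' T w v)\<^sup>2 + 2 * (f' T w v)\<^sup>2"
        using zero_le_power2[of "d w - 2 * f' T w v"] by (simp add: power2_eq_square algebra_simps)
      finally have "(f s w v - f T w v)\<^sup>2 \<le> (T - s)\<^sup>2 * (2 * (d w - f' T w v)\<^sup>2 + 2 * (f' T w v)\<^sup>2)"
        by (simp add: mult_left_mono)
      then have "ennreal ((f s w v - f T w v)\<^sup>2)
          \<le> ennreal ((T - s)\<^sup>2 * (2 * (d w - f' T w v)\<^sup>2 + 2 * (f' T w v)\<^sup>2))"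
        by (rule ennreal_leI)
      also have "\<dots> = ennreal ((T - s)\<^sup>2) * (2 * ennreal ((d w - f' T w v)\<^sup>2) + 2 * ennreal ((f' T w v)\<^sup>2))"
        by (simp add: ennreal_mult ennreal_plus)
      finally show "ennreal ((f s w v - f T w v)\<^sup>2)
          \<le> ennreal ((T - s)\<^sup>2) * (2 * ennreal ((d w - f' T w v)\<^sup>2) + 2 * ennreal ((f' T w v)\<^sup>2))" .
    qed
    also have "\<dots> = ennreal ((T - s)\<^sup>2) * (2 * (\<integral>\<^sup>+w. ennreal ((d w - f' T w v)\<^sup>2) \<partial>P)
        + 2 * (\<integral>\<^sup>+w. ennreal ((f' T w v)\<^sup>2) \<partial>P))"
      by (simp add: nn_integral_cmult nn_integral_add)
    also have "\<dots> \<le> ennreal ((T - s)\<^sup>2) * (2 * 1 + 2 * ennreal J)"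
      using err der by (intro mult_left_mono add_mono) auto
    also have "\<dots> = ennreal ((2 + 2 * J) * (T - s)\<^sup>2)"
      using J(2) by (simp add: ennreal_mult ennreal_plus mult.commute)
    finally show ?case .
  qed
  then show ?thesis
    using that[of "2 + 2 * J"] J(2) by simp
qed

lemma nrm_H10_nonneg: "0 \<le> nrm (H10 G) u"
  by (simp add: H10_def H1_def sum_nonneg)

text \<open>Real simple functions approximating \<open>\<xi>\<close> are multiplied by \<open>v\<close>. The final state \<open>W(T) v\<close> is of this form.\<close>

lemma strongly_measurable_scaleR_const:
  assumes \<xi>: "\<xi> \<in> borel_measurable M"
    and elt: "\<And>c. c *\<^sub>R v \<in> elts X" and nrm: "\<And>c. nrm X (c *\<^sub>R v) = \<bar>c\<bar> * nrm X v"
  shows "strongly_measurable M X (\<lambda>w. \<xi> w *\<^sub>R v)"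
proof -
  obtain s :: "nat \<Rightarrow> _ \<Rightarrow> real" where s: "\<And>k. simple_function M (s k)"
      "\<And>w. w \<in> space M \<Longrightarrow> (\<lambda>k. s k w) \<longlonglongrightarrow> \<xi> w"
    using borel_measurable_implies_sequence_metric[OF \<xi>, of 0] by metis
  have "(\<lambda>k. nrm X (s k w *\<^sub>R v - \<xi> w *\<^sub>R v)) \<longlonglongrightarrow> 0" if "w \<in> space M" for w
  proof -
    have "(\<lambda>k. \<bar>s k w - \<xi> w\<bar> * nrm X v) \<longlonglongrightarrow> \<bar>\<xi> w - \<xi> w\<bar> * nrm X v"
      using s(2)[OF that] by (intro tendsto_intros)
    then show ?thesis
      by (simp add: scaleR_left_diff_distrib[symmetric] nrm)
  qed
  then show ?thesis
    unfolding strongly_measurable_def using s(1) elt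
    by (intro conjI exI[of _ "\<lambda>k w. s k w *\<^sub>R v"]) (auto intro: simple_function_compose1)
qed

lemma L2_scaleR:
  assumes "v \<in> elts (L2 M)"
  shows "c *\<^sub>R v \<in> elts (L2 M)" "nrm (L2 M) (c *\<^sub>R v) = \<bar>c\<bar> * nrm (L2 M) v"
  using assms by (auto simp: L2_def scaleR_fun_def power_mult_distrib real_sqrt_mult)

lemma L2_integral_mult_cong:
  assumes "nrm (L2 M) (u - u') = 0" "u \<in> elts (L2 M)" "u' \<in> elts (L2 M)" "v \<in> elts (L2 M)"
  shows "(\<integral>x. u x * v x \<partial>M) = (\<integral>x. u' x * v x \<partial>M)"
proof -
  have "integrable M (\<lambda>x. ((u - u') x)\<^sup>2)" "(\<integral>x. ((u - u') x)\<^sup>2 \<partial>M) = 0"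
    using L2_diff[OF assms(2,3)] assms(1) by (simp_all add: L2_def)
  then have "AE x in M. ((u - u') x)\<^sup>2 = 0"
    by (subst (asm) integral_nonneg_eq_0_iff_AE) auto
  then have "AE x in M. u x * v x = u' x * v x"
    by eventually_elim simp
  then show ?thesis
    using assms by (intro integral_cong_AE) (auto simp: L2_def)
qed

section \<open>Lack of exact controllability\<close>

theorem theorem6p1:
  fixes P :: "'w measure"
    and W :: "real \<Rightarrow> 'w \<Rightarrow> real"
    and G :: "('a::euclidean_space) set"
    and T :: real
    and a1 a2 :: "real \<Rightarrow> 'w \<Rightarrow> 'a \<Rightarrow> real"
  assumes "prob_space P" and "complete_measure P"
    and "T > 0"
    and "brownian_motion P T W"
    and "bounded_smooth_domain G"
    and "Linf_coeff P (natural_filtration P W) G T a1"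
    and "Linf_coeff P (natural_filtration P W) G T a2"
  shows "\<not> exactly_controllable P (natural_filtration P W) W G T a1 a2"
proof
  let ?F = "natural_filtration P W"
  note W = \<open>brownian_motion P T W\<close>
  interpret prob_space P by fact
  have F: "subalgebra P (?F s)" if "0 \<le> s" "s \<le> T" for s
    using space_natural_filtration[OF W that] sets_natural_filtration_subset[OF W that]
    by (simp add: subalgebra_def)
  have T: "0 \<le> T" "T > 0"
    using \<open>T > 0\<close> by auto
  obtain v where v: "v \<in> elts (H10 G)" "nrm (H10 G) v \<le> 1" "v \<in> elts (L2_dom G)"
      and vv: "(\<integral>x. v x * v x \<partial>lebesgue_on G) > 0"
    using exists_unit_H10[of G] \<open>bounded_smooth_domain G\<close> unfolding bounded_smooth_domain_def by metis
  define c where "c = (\<integral>x. v x * v x \<partial>lebesgue_on G)"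
  \<comment> \<open>The unreachable final state, starting from rest, is \<open>y(T) = W(T) v\<close>, \<open>y\<^sub>t(T) = 0\<close>.\<close>
  define target where "target w = W T w *\<^sub>R v" for w
  have target: "L2_rv P (?F T) (L2_dom G) target"
    unfolding L2_rv_def
  proof
    show "strongly_measurable (?F T) (L2_dom G) target"
      unfolding target_def using brownian_motion_adapted[OF W T(1)] L2_scaleR[OF v(3)]
      by (intro strongly_measurable_scaleR_const) auto
    have "integrable P (\<lambda>w. (W T w - W 0 w)\<^sup>2)"
      using brownian_increment_moments(2)[OF \<open>prob_space P\<close> W order_refl T(2)] .
    moreover have "AE w in P. (W T w - W 0 w)\<^sup>2 = (W T w)\<^sup>2"
    proof -
      have "AE w in P. W 0 w = 0"
        using W by (simp add: brownian_motion_def)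
      then show ?thesis
        by eventually_elim simp
    qed
    moreover have "W T \<in> borel_measurable P" "W 0 \<in> borel_measurable P"
      using W T by (auto simp: brownian_motion_def)
    ultimately have "integrable P (\<lambda>w. (W T w)\<^sup>2)"
      by (subst (asm) integrable_cong_AE) auto
    then have "integrable P (\<lambda>w. (W T w)\<^sup>2 * (nrm (L2_dom G) v)\<^sup>2)"
      by simp
    then have "(\<integral>\<^sup>+w. ennreal ((W T w)\<^sup>2 * (nrm (L2_dom G) v)\<^sup>2) \<partial>P) < \<infinity>"
      by (subst nn_integral_eq_integral) auto
    then show "E_sq P (L2_dom G) target < \<infinity>"
      by (simp add: E_sq_def target_def L2_scaleR[OF v(3)] power_mult_distrib)
  qed
  have zero: "nrm (Hm1 G) 0 = 0"
  proof -
    have "{u \<in> elts (H10 G). nrm (H10 G) u \<le> 1} \<noteq> {}"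
      using v by blast
    then show ?thesis
      by (simp add: Hm1_def dual_nspace_def)
  qed
  have "L2_rv P (?F T) (Hm1 G) (\<lambda>_. 0)"
    unfolding L2_rv_def strongly_measurable_def E_sq_def
    using zero zero_in_dual_nspace by (auto simp: Hm1_def intro!: exI[of _ "\<lambda>_ _. 0"])
  moreover have "0 \<in> elts (L2_dom G)" "0 \<in> elts (Hm1 G)"
    using zero_in_dual_nspace by (auto simp: L2_def Hm1_def zero_fun_def)
  moreover assume "exactly_controllable P ?F W G T a1 a2"
  ultimately have "\<exists>g1 g2 h y yt.
      L2_proc P ?F (Hm1 G) 0 T g1 \<and> L2_proc P ?F (Hm1 G) 0 T g2 \<and> L2_proc P ?F (L2_bdry G) 0 T h \<and>
      transposition_solution P ?F W G T a1 a2 0 0 g1 g2 h y yt \<and>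
      (AE w in P. nrm (L2_dom G) (y T w - target w) = 0 \<and> nrm (Hm1 G) (yt T w - 0) = 0)"
    using target unfolding exactly_controllable_def by blast
  then obtain g1 g2 h y yt where
    sol: "transposition_solution P ?F W G T a1 a2 0 0 g1 g2 h y yt"
    and both: "AE w in P. nrm (L2_dom G) (y T w - target w) = 0 \<and> nrm (Hm1 G) (yt T w - 0) = 0"
    by (elim exE conjE)
  from both have final: "AE w in P. nrm (L2_dom G) (y T w - target w) = 0"
    by (rule eventually_mono) (rule conjunct1)
  define f where "f = (\<lambda>s w. L2_to_Hm1 G (y s w))"
  have y: "C_L2_proc P ?F (L2_dom G) 0 T y"
    using sol unfolding transposition_solution_def by (rule conjunct1)
  have f: "C1_L2_proc P ?F (dual_nspace (H10 G)) 0 T f yt"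
    using sol unfolding transposition_solution_def f_def Hm1_def[symmetric] by (elim conjE)
  have prog_y: "progressive ?F (L2_dom G) 0 T y"
    using y unfolding C_L2_proc_def by (rule conjunct1)
  have prog_f: "progressive ?F (dual_nspace (H10 G)) 0 T f"
    using f unfolding C1_L2_proc_def C_L2_proc_def by (elim conjE)
  have fT: "AE w in P. f T w v = c * W T w"
    using final
  proof (rule AE_mp, intro AE_I2 impI)
    fix w assume w: "w \<in> space P" and eq: "nrm (L2_dom G) (y T w - target w) = 0"
    have "strongly_measurable (?F T) (L2_dom G) (y T)"
      using progressive_imp_adapted[OF prog_y, of T] T by simp
    then have yT: "y T w \<in> elts (L2_dom G)"
      using w F[OF T(1) order_refl] unfolding strongly_measurable_def subalgebra_def by metis
    have "(\<integral>x. y T w x * v x \<partial>lebesgue_on G) = (\<integral>x. target w x * v x \<partial>lebesgue_on G)"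
      by (rule L2_integral_mult_cong[OF eq yT _ v(3)]) (simp only: target_def L2_scaleR(1)[OF v(3)])
    also have "\<dots> = (\<integral>x. W T w * (v x * v x) \<partial>lebesgue_on G)"
      by (simp only: target_def scaleR_fun_def real_scaleR_def mult.assoc)
    also have "\<dots> = c * W T w"
      by (simp only: integral_mult_right_zero c_def mult.commute)
    finally show "f T w v = c * W T w"
      by (simp only: f_def L2_to_Hm1_def)
  qed
  obtain K where K: "K > 0" "\<forall>\<^sub>F s in at_left T.
      (\<integral>\<^sup>+w. ennreal ((f s w v - f T w v)\<^sup>2) \<partial>P) \<le> ennreal (K * (T - s)\<^sup>2)"
    by (rule C1_L2_proc_final_rate[OF \<open>prob_space P\<close> F f T(2) v(1,2) nrm_H10_nonneg])
  have c: "c\<^sup>2 > 0"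
    using vv by (simp add: c_def)
  \<comment> \<open>For \<open>T - s < c\<^sup>2 / K\<close> the upper bound \<open>K (T - s)\<^sup>2\<close> falls below the lower bound \<open>c\<^sup>2 (T - s)\<close>.\<close>
  have "\<forall>\<^sub>F s in at_left T. s \<in> {max 0 (T - c\<^sup>2 / K)<..<T}"
    by (rule eventually_at_leftI[of "max 0 (T - c\<^sup>2 / K)"]) (use T c K(1) in auto)
  with K(2) have "\<forall>\<^sub>F s in at_left T. False"
  proof eventually_elim
    case (elim s)
    then have s: "0 \<le> s" "s < T" "T - s < c\<^sup>2 / K"
      by auto
    have "strongly_measurable (?F s) (dual_nspace (H10 G)) (f s)"
      using progressive_imp_adapted[OF prog_f, of s] s by simp
    then have "(\<lambda>w. f s w v) \<in> borel_measurable (?F s)"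
      by (rule borel_measurable_pairing[OF _ v(1,2) nrm_H10_nonneg])
    then have "ennreal (c\<^sup>2 * (T - s)) \<le> (\<integral>\<^sup>+w. ennreal ((f s w v - c * W T w)\<^sup>2) \<partial>P)"
      by (rule brownian_approximation_error[OF \<open>prob_space P\<close> W s(1,2)])
    also have "\<dots> = (\<integral>\<^sup>+w. ennreal ((f s w v - f T w v)\<^sup>2) \<partial>P)"
    proof (rule nn_integral_cong_AE)
      show "AE w in P. ennreal ((f s w v - c * W T w)\<^sup>2) = ennreal ((f s w v - f T w v)\<^sup>2)"
        using fT by eventually_elim simp
    qed
    also have "\<dots> \<le> ennreal (K * (T - s)\<^sup>2)"
      by (rule elim(1))
    finally have "c\<^sup>2 * (T - s) \<le> K * (T - s)\<^sup>2"
      using K(1) by (subst (asm) ennreal_le_iff) auto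
    then have "c\<^sup>2 \<le> K * (T - s)"
      using s(2) by (simp add: power2_eq_square mult.assoc[symmetric])
    moreover have "K * (T - s) < c\<^sup>2"
      using s(3) K(1) by (simp add: pos_less_divide_eq mult.commute)
    ultimately show False
      by linarith
  qed
  then show False
    by simp
qed

end
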